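(* Let $R$ be an $A$-algebra, let $x=x_1,\dots,x_n$ be an $n$-tuple of elements in $R$, and let $P=A[\mathfrak p(z)]_{z\in R}\subseteq\mathrm{TS}^n_AR$ be the $A$-subalgebra generated by the polarized power sums $\mathfrak p(z)$, $z\in R$. Then the inclusion of $A$-algebras $P\subseteq\mathrm{TS}^n_AR$ becomes an isomorphism after localization with respect to $\alpha^2(x)$.
   Context: All rings are commutative with unit; $n\ge1$. $\mathrm T^n_AR=R\otimes_A\cdots\otimes_AR$ ($n$ factors), $\varphi_p:R\to\mathrm T^n_AR$ is the co-projection on the $p$-th factor, and $\mathrm{TS}^n_AR=(\mathrm T^n_AR)^{\mathfrak S_n}$ is the ring of invariants of the symmetric group permuting the factors. The polarized power sum of $z\in R$ is $\mathfrak p(z)=\varphi_1(z)+\cdots+\varphi_n(z)\in\mathrm{TS}^n_AR$. The alternating tensor is $\alpha(x)=\sum_{\sigma\in\mathfrak S_n}(-1)^{|\sigma|}x_{\sigma(1)}\otimes\cdots\otimes x_{\sigma(n)}$; its square $\alpha^2(x)$ lies in $\mathrm{TS}^n_AR$. One has $\alpha^2(x)=\det(\mathfrak p(x_ix_j))_{i,j}$, so that $\alpha^2(x)\in P$. *)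

theory Defs
  imports "HOL-Library.Poly_Mapping" "HOL-Combinatorics.Permutations"
    "HOL-Algebra.Module" "HOL-Algebra.Subrings" "HOL-Algebra.Generated_Groups"
begin

section \<open>Tensor powers of an algebra\<close>

text \<open>
  The \<open>n\<close> tensor factors are indexed by \<open>{..<n}\<close>. An \<open>n\<close>-tuple of elements of \<open>R\<close> is an
  extensional function on \<open>{..<n}\<close>, and \<open>\<int>[R\<^sup>n]\<close> is the ring of formal integral
  combinations of such tuples, multiplied by extending the componentwise product bilinearly.
\<close>

definition tuples :: "('b, 'm) ring_scheme \<Rightarrow> nat \<Rightarrow> (nat \<Rightarrow> 'b) set"
  where "tuples R n = ({..<n} \<rightarrow>\<^sub>E carrier R)"

definition tuple_mult ::
    "('b, 'm) ring_scheme \<Rightarrow> nat \<Rightarrow> (nat \<Rightarrow> 'b) \<Rightarrow> (nat \<Rightarrow> 'b) \<Rightarrow> (nat \<Rightarrow> 'b)"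
  where "tuple_mult R n x y = (\<lambda>i\<in>{..<n}. x i \<otimes>\<^bsub>R\<^esub> y i)"

definition tuple_ring :: "('b, 'm) ring_scheme \<Rightarrow> nat \<Rightarrow> ((nat \<Rightarrow> 'b) \<Rightarrow>\<^sub>0 int) ring"
  where "tuple_ring R n =
    \<lparr>carrier = {c. Poly_Mapping.keys c \<subseteq> tuples R n},
     mult = (\<lambda>c d. frag_extend (\<lambda>x. frag_extend (\<lambda>y. frag_of (tuple_mult R n x y)) d) c),
     one = frag_of (\<lambda>i\<in>{..<n}. \<one>\<^bsub>R\<^esub>),
     zero = 0,
     add = (+)\<rparr>"

text \<open>
  The subgroup of \<open>\<int>[R\<^sup>n]\<close> generated by the relations of additivity in each factor and
  of moving a scalar of \<open>A\<close> from one factor to another; it is an ideal.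
\<close>

definition tensor_rels ::
    "('a, 'k) ring_scheme \<Rightarrow> ('a, 'b, 'm) module_scheme \<Rightarrow> nat \<Rightarrow> ((nat \<Rightarrow> 'b) \<Rightarrow>\<^sub>0 int) set"
  where "tensor_rels A R n =
    {frag_of (x(i := u \<oplus>\<^bsub>R\<^esub> v)) - frag_of (x(i := u)) - frag_of (x(i := v)) | x i u v.
       x \<in> tuples R n \<and> i < n \<and> u \<in> carrier R \<and> v \<in> carrier R} \<union>
    {frag_of (x(i := a \<odot>\<^bsub>R\<^esub> x i)) - frag_of (x(j := a \<odot>\<^bsub>R\<^esub> x j)) | x i j a.
       x \<in> tuples R n \<and> i < n \<and> j < n \<and> a \<in> carrier A}"

definition tensor_ideal ::
    "('a, 'k) ring_scheme \<Rightarrow> ('a, 'b, 'm) module_scheme \<Rightarrow> nat \<Rightarrow> ((nat \<Rightarrow> 'b) \<Rightarrow>\<^sub>0 int) set"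
  where "tensor_ideal A R n = generate (add_monoid (tuple_ring R n)) (tensor_rels A R n)"

text \<open>The pure tensor \<open>x\<^sub>0 \<otimes> \<dots> \<otimes> x\<^sub>n\<^sub>-\<^sub>1\<close>; only the values of \<open>x\<close> below \<open>n\<close> matter.\<close>

definition pure_tensor ::
    "('a, 'k) ring_scheme \<Rightarrow> ('a, 'b, 'm) module_scheme \<Rightarrow> nat \<Rightarrow> (nat \<Rightarrow> 'b) \<Rightarrow>
     ((nat \<Rightarrow> 'b) \<Rightarrow>\<^sub>0 int) set"
  where "pure_tensor A R n x =
    tensor_ideal A R n +>\<^bsub>tuple_ring R n\<^esub> frag_of (restrict x {..<n})"

definition coproj ::
    "('a, 'k) ring_scheme \<Rightarrow> ('a, 'b, 'm) module_scheme \<Rightarrow> nat \<Rightarrow> nat \<Rightarrow> 'b \<Rightarrow>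
     ((nat \<Rightarrow> 'b) \<Rightarrow>\<^sub>0 int) set"
  where "coproj A R n p z = pure_tensor A R n (\<lambda>i. if i = p then z else \<one>\<^bsub>R\<^esub>)"

text \<open>
  For \<open>n \<ge> 1\<close> this is the \<open>n\<close>-fold tensor product of \<open>R\<close> over \<open>A\<close>. A scalar \<open>a\<close> acts as
  multiplication by \<open>(a \<odot> 1) \<otimes> 1 \<otimes> \<dots> \<otimes> 1\<close>, that is, through any one of the factors.
\<close>

definition tensor_power ::
    "('a, 'k) ring_scheme \<Rightarrow> ('a, 'b, 'm) module_scheme \<Rightarrow> nat \<Rightarrow>
     ('a, ((nat \<Rightarrow> 'b) \<Rightarrow>\<^sub>0 int) set) module"
  where "tensor_power A R n = (let T = tuple_ring R n Quot tensor_ideal A R n in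
    \<lparr>carrier = carrier T, mult = mult T,
     one = one T, zero = zero T, add = add T,
     smult = (\<lambda>a t. coproj A R n 0 (a \<odot>\<^bsub>R\<^esub> \<one>\<^bsub>R\<^esub>) \<otimes>\<^bsub>T\<^esub> t)\<rparr>)"

text \<open>
  Permutation of the factors, \<open>x\<^sub>0 \<otimes> \<dots> \<otimes> x\<^sub>n\<^sub>-\<^sub>1 \<mapsto> x\<^sub>\<sigma>\<^sub>0 \<otimes> \<dots> \<otimes> x\<^sub>\<sigma>\<^sub>(\<^sub>n\<^sub>-\<^sub>1\<^sub>)\<close>, applied
  elementwise to a coset of the tensor ideal.
\<close>

definition permute_factors ::
    "(nat \<Rightarrow> nat) \<Rightarrow> ((nat \<Rightarrow> 'b) \<Rightarrow>\<^sub>0 int) set \<Rightarrow> ((nat \<Rightarrow> 'b) \<Rightarrow>\<^sub>0 int) set"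
  where "permute_factors \<sigma> t = frag_extend (\<lambda>x. frag_of (x \<circ> \<sigma>)) ` t"

definition sym_tensors ::
    "('a, 'k) ring_scheme \<Rightarrow> ('a, 'b, 'm) module_scheme \<Rightarrow> nat \<Rightarrow>
     ('a, ((nat \<Rightarrow> 'b) \<Rightarrow>\<^sub>0 int) set) module"
  where "sym_tensors A R n = (tensor_power A R n)
    \<lparr>carrier := {t \<in> carrier (tensor_power A R n).
       \<forall>\<sigma>. \<sigma> permutes {..<n} \<longrightarrow> permute_factors \<sigma> t = t}\<rparr>"

definition power_sum ::
    "('a, 'k) ring_scheme \<Rightarrow> ('a, 'b, 'm) module_scheme \<Rightarrow> nat \<Rightarrow> 'b \<Rightarrow>
     ((nat \<Rightarrow> 'b) \<Rightarrow>\<^sub>0 int) set"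
  where "power_sum A R n z = (\<Oplus>\<^bsub>tensor_power A R n\<^esub>p\<in>{..<n}. coproj A R n p z)"

definition alt_tensor ::
    "('a, 'k) ring_scheme \<Rightarrow> ('a, 'b, 'm) module_scheme \<Rightarrow> nat \<Rightarrow> (nat \<Rightarrow> 'b) \<Rightarrow>
     ((nat \<Rightarrow> 'b) \<Rightarrow>\<^sub>0 int) set"
  where "alt_tensor A R n x =
    (\<Oplus>\<^bsub>tensor_power A R n\<^esub>\<sigma>\<in>{\<sigma>. \<sigma> permutes {..<n}}.
       [sign \<sigma>] \<cdot>\<^bsub>tensor_power A R n\<^esub> pure_tensor A R n (\<lambda>i. x (\<sigma> i)))"

definition alt_tensor_sq ::
    "('a, 'k) ring_scheme \<Rightarrow> ('a, 'b, 'm) module_scheme \<Rightarrow> nat \<Rightarrow> (nat \<Rightarrow> 'b) \<Rightarrow>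
     ((nat \<Rightarrow> 'b) \<Rightarrow>\<^sub>0 int) set"
  where "alt_tensor_sq A R n x = alt_tensor A R n x \<otimes>\<^bsub>tensor_power A R n\<^esub> alt_tensor A R n x"


section \<open>Subalgebras and isomorphisms of algebras\<close>

definition is_subalgebra :: "('a, 'k) ring_scheme \<Rightarrow> ('a, 'b, 'm) module_scheme \<Rightarrow> 'b set \<Rightarrow> bool"
  where "is_subalgebra A M B \<longleftrightarrow>
    subring B M \<and> (\<forall>a\<in>carrier A. \<forall>b\<in>B. a \<odot>\<^bsub>M\<^esub> b \<in> B)"

definition generated_subalgebra ::
    "('a, 'k) ring_scheme \<Rightarrow> ('a, 'b, 'm) module_scheme \<Rightarrow> 'b set \<Rightarrow> ('a, 'b, 'm) module_scheme"
  where "generated_subalgebra A M X = M\<lparr>carrier := \<Inter>{B. is_subalgebra A M B \<and> X \<subseteq> B}\<rparr>"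

definition power_sum_algebra ::
    "('a, 'k) ring_scheme \<Rightarrow> ('a, 'b, 'm) module_scheme \<Rightarrow> nat \<Rightarrow>
     ('a, ((nat \<Rightarrow> 'b) \<Rightarrow>\<^sub>0 int) set) module"
  where "power_sum_algebra A R n =
    generated_subalgebra A (sym_tensors A R n) (power_sum A R n ` carrier R)"

definition algebra_iso ::
    "('a, 'k) ring_scheme \<Rightarrow> ('a, 'b, 'm) module_scheme \<Rightarrow> ('a, 'c, 'l) module_scheme \<Rightarrow> ('b \<Rightarrow> 'c) set"
  where "algebra_iso A M N =
    {h \<in> ring_iso M N. \<forall>a\<in>carrier A. \<forall>x\<in>carrier M. h (a \<odot>\<^bsub>M\<^esub> x) = a \<odot>\<^bsub>N\<^esub> h x}"


section \<open>Localization at an element\<close>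

definition powers :: "('b, 'm) monoid_scheme \<Rightarrow> 'b \<Rightarrow> 'b set"
  where "powers M f = range (\<lambda>k::nat. f [^]\<^bsub>M\<^esub> k)"

text \<open>Pairs \<open>(x, s)\<close> stand for fractions \<open>x / s\<close> whose denominator is a power of \<open>f\<close>.\<close>

definition frac_rel :: "('b, 'm) ring_scheme \<Rightarrow> 'b \<Rightarrow> (('b \<times> 'b) \<times> ('b \<times> 'b)) set"
  where "frac_rel M f =
    {((x, s), (y, t)). x \<in> carrier M \<and> s \<in> powers M f \<and> y \<in> carrier M \<and> t \<in> powers M f \<and>
       (\<exists>u\<in>powers M f. u \<otimes>\<^bsub>M\<^esub> (x \<otimes>\<^bsub>M\<^esub> t) = u \<otimes>\<^bsub>M\<^esub> (y \<otimes>\<^bsub>M\<^esub> s))}"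

definition localization :: "('a, 'b, 'm) module_scheme \<Rightarrow> 'b \<Rightarrow> ('a, ('b \<times> 'b) set) module"
  where "localization M f =
    \<lparr>carrier = (carrier M \<times> powers M f) // frac_rel M f,
     mult = (\<lambda>X Y. \<Union>(x, s)\<in>X. \<Union>(y, t)\<in>Y. frac_rel M f `` {(x \<otimes>\<^bsub>M\<^esub> y, s \<otimes>\<^bsub>M\<^esub> t)}),
     one = frac_rel M f `` {(\<one>\<^bsub>M\<^esub>, \<one>\<^bsub>M\<^esub>)},
     zero = frac_rel M f `` {(\<zero>\<^bsub>M\<^esub>, \<one>\<^bsub>M\<^esub>)},
     add = (\<lambda>X Y. \<Union>(x, s)\<in>X. \<Union>(y, t)\<in>Y.
              frac_rel M f `` {(x \<otimes>\<^bsub>M\<^esub> t \<oplus>\<^bsub>M\<^esub> y \<otimes>\<^bsub>M\<^esub> s, s \<otimes>\<^bsub>M\<^esub> t)}),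
     smult = (\<lambda>a X. \<Union>(x, s)\<in>X. frac_rel M f `` {(a \<odot>\<^bsub>M\<^esub> x, s)})\<rparr>"

text \<open>The map \<open>x / s \<mapsto> h x / h s\<close> induced by \<open>h\<close> on the localizations at \<open>f\<close> and \<open>h f\<close>.\<close>

definition localization_map ::
    "('b \<Rightarrow> 'c) \<Rightarrow> ('a, 'c, 'l) module_scheme \<Rightarrow> 'b \<Rightarrow> ('b \<times> 'b) set \<Rightarrow> ('c \<times> 'c) set"
  where "localization_map h N f X = (\<Union>(x, s)\<in>X. frac_rel N (h f) `` {(h x, h s)})"

end

theory Submission
  imports Defs
begin

text \<open>
  Let \<open>Tr(u)\<close> be the sum of the images of \<open>u\<close> under all permutations of the factors. If
  \<open>\<alpha> = \<alpha>(x)\<close> and \<open>t\<close> is symmetric, then \<open>\<alpha>\<^sup>2 t = Tr((x\<^sub>1 \<otimes> \<dots> \<otimes> x\<^sub>n) \<alpha> t)\<close>,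
  because permuting the factors of \<open>\<alpha>\<close> multiplies it by the sign. The trace of a pure tensor is a sum
  of products of co-projections over the injections of \<open>{1,\<dots>,n}\<close> into itself; such sums over
  injections of \<open>{1,\<dots>,k}\<close> are polynomials in the power sums by induction on \<open>k\<close>. Hence
  multiplication by \<open>\<alpha>\<^sup>2\<close> maps all symmetric tensors into \<open>P\<close>, and inverting \<open>\<alpha>\<^sup>2\<close> identifies
  the two algebras.
\<close>

section \<open>Localization of a subalgebra\<close>

text \<open>Taking the trace of a symmetric tensor \<open>t\<close> itself would only give
  \<open>n! t\<close>, which is of no use when \<open>n!\<close> is not invertible. The alternating
  tensor replaces this average: one of the two factors \<alpha> is written as its signed sum over
  permutations, and each sign is absorbed by the other factor, so that \<alpha>^2 t becomes a trace
  exactly, with no integer factor. The recursion over injections is free of denominators for the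
  same purpose: its correction terms are subtracted and nothing is divided.

  One and the same element \<alpha>^2 works for every \<open>t\<close>, so surjectivity of the
  localized map is a one-step expansion of fractions, and the membership of \<alpha>^2 in
  \<open>P\<close> is the case \<open>t = 1\<close>.

  Tensors are cosets of formal sums of tuples. Identities between them are checked on tuples or pure
  tensors and extended additively.\<close>

context cring
begin

lemma powers_subset_carrier: "f \<in> carrier R \<Longrightarrow> powers R f \<subseteq> carrier R"
  by (auto simp: powers_def)

lemma one_in_powers: "\<one> \<in> powers R f"
  unfolding powers_def by (rule image_eqI[where x = 0]) simp_all

lemma powers_mult_closed:
  assumes "f \<in> carrier R" "s \<in> powers R f" "t \<in> powers R f"
  shows "s \<otimes> t \<in> powers R f"
  using assms by (auto simp: powers_def nat_pow_mult)

lemma self_in_powers: "f \<in> carrier R \<Longrightarrow> f \<in> powers R f"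
  unfolding powers_def by (rule image_eqI[where x = 1]) simp_all

lemma frac_relD:
  assumes "((x, s), (y, t)) \<in> frac_rel R f"
  obtains u where "x \<in> carrier R" "s \<in> powers R f" "y \<in> carrier R" "t \<in> powers R f"
    "u \<in> powers R f" "u \<otimes> (x \<otimes> t) = u \<otimes> (y \<otimes> s)"
  using assms by (auto simp: frac_rel_def)

lemma frac_relI:
  assumes "x \<in> carrier R" "s \<in> powers R f" "y \<in> carrier R" "t \<in> powers R f"
    "u \<in> powers R f" "u \<otimes> (x \<otimes> t) = u \<otimes> (y \<otimes> s)"
  shows "((x, s), (y, t)) \<in> frac_rel R f"
  using assms by (auto simp: frac_rel_def)

lemma equiv_frac_rel:
  assumes f: "f \<in> carrier R"
  shows "equiv (carrier R \<times> powers R f) (frac_rel R f)"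
proof (rule equivI)
  show "frac_rel R f \<subseteq> (carrier R \<times> powers R f) \<times> (carrier R \<times> powers R f)"
    by (auto simp: frac_rel_def)
  show "refl_on (carrier R \<times> powers R f) (frac_rel R f)"
    using one_in_powers by (auto simp: refl_on_def frac_rel_def)
  show "sym (frac_rel R f)"
    by (auto simp: sym_def frac_rel_def intro: sym)
  show "trans (frac_rel R f)"
  proof (rule transI, clarify)
    fix x s y t z r
    assume 1: "((x, s), (y, t)) \<in> frac_rel R f" and 2: "((y, t), (z, r)) \<in> frac_rel R f"
    from 1 obtain u where u: "x \<in> carrier R" "s \<in> powers R f" "y \<in> carrier R" "t \<in> powers R f"
      "u \<in> powers R f" "u \<otimes> (x \<otimes> t) = u \<otimes> (y \<otimes> s)" by (rule frac_relD)
    from 2 obtain v where v: "z \<in> carrier R" "r \<in> powers R f"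
      "v \<in> powers R f" "v \<otimes> (y \<otimes> r) = v \<otimes> (z \<otimes> t)" by (rule frac_relD)
    note P = subsetD[OF powers_subset_carrier[OF f]]
    note C = u(1,3) v(1) P[OF u(2)] P[OF u(4)] P[OF u(5)] P[OF v(2)] P[OF v(3)]
    \<comment> \<open>The denominator \<open>t\<close> of the middle fraction may be a zero divisor,
      so it joins the witness: the first equation is scaled by \<open>v r\<close>, the second by
      \<open>u s\<close>.\<close>
    have "u \<otimes> v \<otimes> t \<otimes> (x \<otimes> r) = (v \<otimes> r) \<otimes> (u \<otimes> (x \<otimes> t))" using C by (simp add: m_ac)
    also have "\<dots> = (u \<otimes> s) \<otimes> (v \<otimes> (y \<otimes> r))" unfolding u(6) using C by (simp add: m_ac)
    also have "\<dots> = u \<otimes> v \<otimes> t \<otimes> (z \<otimes> s)" unfolding v(4) using C by (simp add: m_ac)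
    finally show "((x, s), (z, r)) \<in> frac_rel R f"
      using u v by (intro frac_relI[where u = "u \<otimes> v \<otimes> t"]) (auto intro: powers_mult_closed[OF f])
  qed
qed

lemma frac_mult_cong:
  assumes f: "f \<in> carrier R"
    and 1: "((x, s), (x', s')) \<in> frac_rel R f" and 2: "((y, t), (y', t')) \<in> frac_rel R f"
  shows "((x \<otimes> y, s \<otimes> t), (x' \<otimes> y', s' \<otimes> t')) \<in> frac_rel R f"
proof -
  from 1 obtain u where u: "x \<in> carrier R" "s \<in> powers R f" "x' \<in> carrier R" "s' \<in> powers R f"
    "u \<in> powers R f" "u \<otimes> (x \<otimes> s') = u \<otimes> (x' \<otimes> s)" by (rule frac_relD)
  from 2 obtain v where v: "y \<in> carrier R" "t \<in> powers R f" "y' \<in> carrier R" "t' \<in> powers R f"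
    "v \<in> powers R f" "v \<otimes> (y \<otimes> t') = v \<otimes> (y' \<otimes> t)" by (rule frac_relD)
  note P = subsetD[OF powers_subset_carrier[OF f]]
  note C = u(1,3) v(1,3) P[OF u(2)] P[OF u(4)] P[OF u(5)] P[OF v(2)] P[OF v(4)] P[OF v(5)]
  have "u \<otimes> v \<otimes> (x \<otimes> y \<otimes> (s' \<otimes> t')) = (u \<otimes> (x \<otimes> s')) \<otimes> (v \<otimes> (y \<otimes> t'))"
    using C by (simp add: m_ac)
  also have "\<dots> = u \<otimes> v \<otimes> (x' \<otimes> y' \<otimes> (s \<otimes> t))"
    unfolding u(6) v(6) using C by (simp add: m_ac)
  finally show ?thesis
    using u v by (intro frac_relI[where u = "u \<otimes> v"]) (auto intro: powers_mult_closed[OF f])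
qed

lemma frac_add_cong:
  assumes f: "f \<in> carrier R"
    and 1: "((x, s), (x', s')) \<in> frac_rel R f" and 2: "((y, t), (y', t')) \<in> frac_rel R f"
  shows "((x \<otimes> t \<oplus> y \<otimes> s, s \<otimes> t), (x' \<otimes> t' \<oplus> y' \<otimes> s', s' \<otimes> t')) \<in> frac_rel R f"
proof -
  from 1 obtain u where u: "x \<in> carrier R" "s \<in> powers R f" "x' \<in> carrier R" "s' \<in> powers R f"
    "u \<in> powers R f" "u \<otimes> (x \<otimes> s') = u \<otimes> (x' \<otimes> s)" by (rule frac_relD)
  from 2 obtain v where v: "y \<in> carrier R" "t \<in> powers R f" "y' \<in> carrier R" "t' \<in> powers R f"
    "v \<in> powers R f" "v \<otimes> (y \<otimes> t') = v \<otimes> (y' \<otimes> t)" by (rule frac_relD)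
  note P = subsetD[OF powers_subset_carrier[OF f]]
  note C = u(1,3) v(1,3) P[OF u(2)] P[OF u(4)] P[OF u(5)] P[OF v(2)] P[OF v(4)] P[OF v(5)]
  have "u \<otimes> v \<otimes> ((x \<otimes> t \<oplus> y \<otimes> s) \<otimes> (s' \<otimes> t')) =
      (v \<otimes> t \<otimes> t') \<otimes> (u \<otimes> (x \<otimes> s')) \<oplus> (u \<otimes> s \<otimes> s') \<otimes> (v \<otimes> (y \<otimes> t'))"
    using C by (simp add: m_ac l_distr r_distr)
  also have "\<dots> = u \<otimes> v \<otimes> ((x' \<otimes> t' \<oplus> y' \<otimes> s') \<otimes> (s \<otimes> t))"
    unfolding u(6) v(6) using C by (simp add: m_ac l_distr r_distr)
  finally show ?thesis
    using u v C by (intro frac_relI[where u = "u \<otimes> v"]) (auto intro: powers_mult_closed[OF f])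
qed

end

text \<open>The product of classes is a union over all pairs of representatives. By congruence all
  the sets in this union are equal, so it collapses to the class computed from any one pair.\<close>

lemma localization_mult:
  assumes "cring M" and f: "f \<in> carrier M"
    and "x \<in> carrier M" "s \<in> powers M f" "y \<in> carrier M" "t \<in> powers M f"
  shows "frac_rel M f `` {(x, s)} \<otimes>\<^bsub>localization M f\<^esub> frac_rel M f `` {(y, t)} =
    frac_rel M f `` {(x \<otimes>\<^bsub>M\<^esub> y, s \<otimes>\<^bsub>M\<^esub> t)}"
proof -
  interpret cring M by fact
  note e = equiv_frac_rel[OF f]
  have "congruent2 (frac_rel M f) (frac_rel M f)
      (\<lambda>p q. frac_rel M f `` {(fst p \<otimes>\<^bsub>M\<^esub> fst q, snd p \<otimes>\<^bsub>M\<^esub> snd q)})"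
    by (auto intro!: congruent2I' equiv_class_eq[OF e] frac_mult_cong[OF f])
  from UN_equiv_class2[OF e e this, of "(x, s)" "(y, t)"] assms(3-) show ?thesis
    by (simp add: localization_def split_def)
qed

lemma localization_add:
  assumes "cring M" and f: "f \<in> carrier M"
    and "x \<in> carrier M" "s \<in> powers M f" "y \<in> carrier M" "t \<in> powers M f"
  shows "frac_rel M f `` {(x, s)} \<oplus>\<^bsub>localization M f\<^esub> frac_rel M f `` {(y, t)} =
    frac_rel M f `` {(x \<otimes>\<^bsub>M\<^esub> t \<oplus>\<^bsub>M\<^esub> y \<otimes>\<^bsub>M\<^esub> s, s \<otimes>\<^bsub>M\<^esub> t)}"
proof -
  interpret cring M by fact
  note e = equiv_frac_rel[OF f]
  have "congruent2 (frac_rel M f) (frac_rel M f) (\<lambda>p q. frac_rel M f ``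
      {(fst p \<otimes>\<^bsub>M\<^esub> snd q \<oplus>\<^bsub>M\<^esub> fst q \<otimes>\<^bsub>M\<^esub> snd p, snd p \<otimes>\<^bsub>M\<^esub> snd q)})"
    by (auto intro!: congruent2I' equiv_class_eq[OF e] frac_add_cong[OF f])
  from UN_equiv_class2[OF e e this, of "(x, s)" "(y, t)"] assms(3-) show ?thesis
    by (simp add: localization_def split_def)
qed

lemma localization_smult:
  assumes "cring M" and f: "f \<in> carrier M"
    and closed: "\<And>y. y \<in> carrier M \<Longrightarrow> a \<odot>\<^bsub>M\<^esub> y \<in> carrier M"
    and assoc: "\<And>y z. y \<in> carrier M \<Longrightarrow> z \<in> carrier M \<Longrightarrow>
      (a \<odot>\<^bsub>M\<^esub> y) \<otimes>\<^bsub>M\<^esub> z = a \<odot>\<^bsub>M\<^esub> (y \<otimes>\<^bsub>M\<^esub> z)"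
    and "x \<in> carrier M" "s \<in> powers M f"
  shows "a \<odot>\<^bsub>localization M f\<^esub> frac_rel M f `` {(x, s)} = frac_rel M f `` {(a \<odot>\<^bsub>M\<^esub> x, s)}"
proof -
  interpret cring M by fact
  note e = equiv_frac_rel[OF f]
  note P = subsetD[OF powers_subset_carrier[OF f]]
  have rel: "((a \<odot>\<^bsub>M\<^esub> y, t), (a \<odot>\<^bsub>M\<^esub> z, r)) \<in> frac_rel M f"
    if "((y, t), (z, r)) \<in> frac_rel M f" for y t z r
  proof -
    from that obtain u where u: "y \<in> carrier M" "t \<in> powers M f" "z \<in> carrier M" "r \<in> powers M f"
      "u \<in> powers M f" "u \<otimes>\<^bsub>M\<^esub> (y \<otimes>\<^bsub>M\<^esub> r) = u \<otimes>\<^bsub>M\<^esub> (z \<otimes>\<^bsub>M\<^esub> t)" by (rule frac_relD)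
    \<comment> \<open>With the scalar pulled to the front, the witness \<open>u\<close> of the given
      relation serves for the scaled one.\<close>
    have sm: "u \<otimes>\<^bsub>M\<^esub> ((a \<odot>\<^bsub>M\<^esub> w) \<otimes>\<^bsub>M\<^esub> q) = a \<odot>\<^bsub>M\<^esub> (u \<otimes>\<^bsub>M\<^esub> (w \<otimes>\<^bsub>M\<^esub> q))"
      if "w \<in> carrier M" "q \<in> powers M f" for w q
      using that P[OF u(5)] P[OF that(2)] closed
      by (simp add: assoc m_comm[of u] m_closed)
    show ?thesis
      using u closed by (intro frac_relI[where u = u]) (simp_all add: sm)
  qed
  have "congruent (frac_rel M f) (\<lambda>p. frac_rel M f `` {(a \<odot>\<^bsub>M\<^esub> fst p, snd p)})"
    by (auto intro!: congruentI equiv_class_eq[OF e] rel)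
  from UN_equiv_class[OF e this, of "(x, s)"] assms(5-) show ?thesis
    by (simp add: localization_def split_def)
qed

text \<open>\<open>mult_mem\<close> puts \<open>f\<close> into the conductor of \<open>M\<close>
  into \<open>B\<close>, which yields surjectivity. For injectivity, equality of two fractions with
  numerators in \<open>B\<close> is witnessed by a power of \<open>f\<close>, and \<open>f\<close>
  has the same powers in \<open>B\<close> as in \<open>M\<close>.\<close>

lemma localization_map_inclusion_iso:
  assumes "cring M" and B: "subring B M" and fB: "f \<in> B"
    and sB: "\<And>a b. a \<in> carrier A \<Longrightarrow> b \<in> B \<Longrightarrow> a \<odot>\<^bsub>M\<^esub> b \<in> B"
    and sM: "\<And>a b. a \<in> carrier A \<Longrightarrow> b \<in> carrier M \<Longrightarrow> a \<odot>\<^bsub>M\<^esub> b \<in> carrier M"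
    and assoc: "\<And>a y z. a \<in> carrier A \<Longrightarrow> y \<in> carrier M \<Longrightarrow> z \<in> carrier M \<Longrightarrow>
      (a \<odot>\<^bsub>M\<^esub> y) \<otimes>\<^bsub>M\<^esub> z = a \<odot>\<^bsub>M\<^esub> (y \<otimes>\<^bsub>M\<^esub> z)"
    and mult_mem: "\<And>t. t \<in> carrier M \<Longrightarrow> f \<otimes>\<^bsub>M\<^esub> t \<in> B"
  shows "localization_map (\<lambda>t. t) M f
    \<in> algebra_iso A (localization (M\<lparr>carrier := B\<rparr>) f) (localization M f)"
proof -
  interpret M: cring M by fact
  define P where "P = M\<lparr>carrier := B\<rparr>"
  have P_simps [simp]: "carrier P = B" "mult P = mult M" "add P = add M" "one P = one M"
    "zero P = zero M" "smult P = smult M"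
    by (simp_all add: P_def)
  have BM: "B \<subseteq> carrier M" using B by (rule subringE)
  have "cring P"
    unfolding P_def using M.subcring_iff[OF BM] M.subcringI'[OF B] by simp
  then interpret P: cring P .
  have fM: "f \<in> carrier M" using fB BM by blast
  have fP: "f \<in> carrier P" using fB by simp
  have pow: "powers P f = powers M f"
    unfolding powers_def P_def by (simp flip: M.nat_pow_consistent)
  note S = subsetD[OF M.powers_subset_carrier[OF fM]]
  note SB = subsetD[OF P.powers_subset_carrier[OF fP], unfolded pow P_simps]
  have rel_P: "((x, s), (y, t)) \<in> frac_rel P f \<longleftrightarrow> x \<in> B \<and> y \<in> B \<and> ((x, s), (y, t)) \<in> frac_rel M f"
    for x s y t
    using BM by (auto simp: frac_rel_def pow)
  note eM = M.equiv_frac_rel[OF fM]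
  note eP = P.equiv_frac_rel[OF fP]
  let ?h = "localization_map (\<lambda>t. t) M f"
  have h: "?h (frac_rel P f `` {(x, s)}) = frac_rel M f `` {(x, s)}"
    if "x \<in> B" "s \<in> powers M f" for x s
  proof -
    have "congruent (frac_rel P f) (\<lambda>p. frac_rel M f `` {p})"
      by (auto intro!: congruentI equiv_class_eq[OF eM] simp: rel_P)
    from UN_equiv_class[OF eP this, of "(x, s)"] that show ?thesis
      by (simp add: localization_map_def split_def pow)
  qed
  have carP: "\<exists>x s. X = frac_rel P f `` {(x, s)} \<and> x \<in> B \<and> s \<in> powers M f"
    if "X \<in> carrier (localization P f)" for X
    using that by (auto simp: localization_def pow elim!: quotientE)
  have inP: "frac_rel P f `` {(x, s)} \<in> carrier (localization P f)"
    if "x \<in> B" "s \<in> powers M f" for x s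
    using that by (auto simp: localization_def pow intro!: quotientI)
  have carM: "\<exists>x s. X = frac_rel M f `` {(x, s)} \<and> x \<in> carrier M \<and> s \<in> powers M f"
    if "X \<in> carrier (localization M f)" for X
    using that by (auto simp: localization_def elim!: quotientE)
  have inM: "frac_rel M f `` {(x, s)} \<in> carrier (localization M f)"
    if "x \<in> carrier M" "s \<in> powers M f" for x s
    using that by (auto simp: localization_def intro!: quotientI)
  have mP: "s \<otimes>\<^bsub>M\<^esub> t \<in> powers M f" if "s \<in> powers M f" "t \<in> powers M f" for s t
    using M.powers_mult_closed[OF fM] that by blast
  note sub = subringE[OF B]
  have "?h \<in> ring_iso (localization P f) (localization M f)"
    unfolding ring_iso_def
  proof (intro CollectI conjI ring_hom_memI)
    fix X assume "X \<in> carrier (localization P f)"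
    then obtain x s where "X = frac_rel P f `` {(x, s)}" "x \<in> B" "s \<in> powers M f"
      using carP by blast
    then show "?h X \<in> carrier (localization M f)"
      using BM by (auto simp: h intro!: inM)
  next
    fix X Y assume "X \<in> carrier (localization P f)" "Y \<in> carrier (localization P f)"
    then obtain x s y t where X: "X = frac_rel P f `` {(x, s)}" "x \<in> B" "s \<in> powers M f"
      and Y: "Y = frac_rel P f `` {(y, t)}" "y \<in> B" "t \<in> powers M f"
      using carP by metis
    show "?h (X \<otimes>\<^bsub>localization P f\<^esub> Y) = ?h X \<otimes>\<^bsub>localization M f\<^esub> ?h Y"
      using X(2,3) Y(2,3) BM localization_mult[OF P.is_cring fP, of x s y t]
        localization_mult[OF M.is_cring fM, of x s y t]
      by (simp add: X(1) Y(1) h pow sub mP subset_eq)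
    show "?h (X \<oplus>\<^bsub>localization P f\<^esub> Y) = ?h X \<oplus>\<^bsub>localization M f\<^esub> ?h Y"
      using X(2,3) Y(2,3) BM localization_add[OF P.is_cring fP, of x s y t]
        localization_add[OF M.is_cring fM, of x s y t]
      by (simp add: X(1) Y(1) h pow sub mP SB subset_eq)
  next
    show "?h \<one>\<^bsub>localization P f\<^esub> = \<one>\<^bsub>localization M f\<^esub>"
      using h[of "\<one>\<^bsub>M\<^esub>" "\<one>\<^bsub>M\<^esub>"] sub(3) M.one_in_powers by (simp add: localization_def)
  next
    show "bij_betw ?h (carrier (localization P f)) (carrier (localization M f))"
    proof (rule bij_betw_imageI)
      show "inj_on ?h (carrier (localization P f))"
      proof (rule inj_onI)
        fix X Y assume "X \<in> carrier (localization P f)" "Y \<in> carrier (localization P f)"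
          and eq: "?h X = ?h Y"
        then obtain x s y t where X: "X = frac_rel P f `` {(x, s)}" "x \<in> B" "s \<in> powers M f"
          and Y: "Y = frac_rel P f `` {(y, t)}" "y \<in> B" "t \<in> powers M f"
          using carP by metis
        have "((x, s), (y, t)) \<in> frac_rel M f"
          using eq X(2,3) Y(2,3) BM eq_equiv_class[OF _ eM, of "(x, s)" "(y, t)"]
          by (auto simp: X(1) Y(1) h)
        then have "((x, s), (y, t)) \<in> frac_rel P f" using X Y rel_P by blast
        then show "X = Y" unfolding X(1) Y(1) by (rule equiv_class_eq[OF eP])
      qed
      show "?h ` carrier (localization P f) = carrier (localization M f)"
      proof (intro equalityI subsetI)
        fix X assume "X \<in> ?h ` carrier (localization P f)"
        then show "X \<in> carrier (localization M f)" using carP BM by (force simp: h intro!: inM)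
      next
        fix X assume "X \<in> carrier (localization M f)"
        then obtain x s where X: "X = frac_rel M f `` {(x, s)}" "x \<in> carrier M" "s \<in> powers M f"
          using carM by blast
        have fs: "f \<otimes>\<^bsub>M\<^esub> s \<in> powers M f" using mP M.self_in_powers fM X by blast
        \<comment> \<open>Expanding a fraction by \<open>f\<close> moves its numerator into
          \<open>B\<close> and leaves its class unchanged; the witness is \<open>1\<close>.\<close>
        have "((x, s), (f \<otimes>\<^bsub>M\<^esub> x, f \<otimes>\<^bsub>M\<^esub> s)) \<in> frac_rel M f"
          using X fs fM S[OF X(3)]
          by (intro M.frac_relI[where u = "\<one>\<^bsub>M\<^esub>"]) (auto intro: M.one_in_powers simp: M.m_ac)
        then have "X = ?h (frac_rel P f `` {(f \<otimes>\<^bsub>M\<^esub> x, f \<otimes>\<^bsub>M\<^esub> s)})"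
          using h[OF mult_mem fs] X equiv_class_eq[OF eM] by simp
        then show "X \<in> ?h ` carrier (localization P f)"
          using inP[OF mult_mem fs] X(2) by blast
      qed
    qed
  qed
  moreover have "?h (a \<odot>\<^bsub>localization P f\<^esub> X) = a \<odot>\<^bsub>localization M f\<^esub> ?h X"
    if a: "a \<in> carrier A" and X: "X \<in> carrier (localization P f)" for a X
  proof -
    from carP[OF X] obtain x s where X: "X = frac_rel P f `` {(x, s)}" "x \<in> B" "s \<in> powers M f"
      by blast
    show ?thesis
      using X(2,3) BM localization_smult[OF P.is_cring fP, of a x s]
        localization_smult[OF M.is_cring fM, of a x s] sB[OF a] sM[OF a] assoc[OF a]
      by (simp add: X(1) h pow subset_eq)
  qed
  ultimately show ?thesis unfolding algebra_iso_def P_def by blast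
qed

section \<open>Sums over injections\<close>

lemma (in abelian_monoid) finsum_Sigma:
  assumes "finite A" "\<And>a. a \<in> A \<Longrightarrow> finite (B a)"
    and "\<And>a b. a \<in> A \<Longrightarrow> b \<in> B a \<Longrightarrow> g a b \<in> carrier G"
  shows "(\<Oplus>a\<in>A. \<Oplus>b\<in>B a. g a b) = (\<Oplus>x\<in>Sigma A B. g (fst x) (snd x))"
  using assms
proof (induction A rule: finite_induct)
  case empty
  then show ?case by simp
next
  case (insert a A)
  have eq: "Sigma (insert a A) B = Pair a ` B a \<union> Sigma A B" by auto
  have "(\<Oplus>x\<in>Sigma (insert a A) B. g (fst x) (snd x)) =
      (\<Oplus>x\<in>Pair a ` B a. g (fst x) (snd x)) \<oplus> (\<Oplus>x\<in>Sigma A B. g (fst x) (snd x))"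
    unfolding eq by (rule finsum_Un_disjoint) (use insert in auto)
  moreover have "(\<Oplus>x\<in>Pair a ` B a. g (fst x) (snd x)) = (\<Oplus>b\<in>B a. g a b)"
    by (subst finsum_reindex) (use insert in \<open>auto simp: inj_on_def\<close>)
  ultimately show ?case
    using insert by (simp add: finsum_closed Pi_def)
qed

lemma (in ring) subring_finsum_closed:
  assumes "subring B R" "\<And>a. a \<in> S \<Longrightarrow> g a \<in> B"
  shows "(\<Oplus>a\<in>S. g a) \<in> B"
proof (cases "finite S")
  case True
  then show ?thesis using assms(2)
  proof (induction S rule: finite_induct)
    case empty
    then show ?case using subringE(2)[OF assms(1)] by simp
  next
    case (insert a S)
    then show ?case
      using subringE(1,7)[OF assms(1)] by (subst finsum_insert) auto
  qed
next
  case False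
  then show ?thesis using subringE(2)[OF assms(1)] by (simp add: finsum_infinite)
qed

text \<open>Extensionality makes an injection determined by its values below \<open>k\<close>. The
  set is therefore finite for finite \<open>I\<close>, and a singleton for \<open>k = 0\<close>,
  where the sum reduces to the empty product.\<close>

definition injections :: "nat \<Rightarrow> 'i set \<Rightarrow> (nat \<Rightarrow> 'i) set"
  where "injections k I = {f \<in> {..<k} \<rightarrow>\<^sub>E I. inj_on f {..<k}}"

lemma finite_injections: "finite I \<Longrightarrow> finite (injections k I)"
  by (simp add: injections_def finite_PiE)

lemma injections_0: "injections 0 I = {\<lambda>_. undefined}"
  by (auto simp: injections_def)

text \<open>Peels off the last index, which is \<open>k\<close>, so that a sum over
  \<open>injections (Suc k) I\<close> becomes a double sum whose inner range is the complement of an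
  image.\<close>

lemma injections_Suc:
  "bij_betw (\<lambda>(f, p). f(k := p)) (SIGMA f:injections k I. I - f ` {..<k}) (injections (Suc k) I)"
  (is "bij_betw ?h ?S ?T")
proof (rule bij_betw_byWitness[where f' = "\<lambda>f. (restrict f {..<k}, f k)"])
  show "\<forall>a\<in>?S. (restrict (?h a) {..<k}, ?h a k) = a"
    by (auto simp: injections_def PiE_def extensional_def restrict_def fun_eq_iff)
  show "\<forall>f\<in>?T. ?h (restrict f {..<k}, f k) = f"
    by (auto simp: injections_def PiE_def extensional_def restrict_def fun_eq_iff)
  show "?h ` ?S \<subseteq> ?T"
  proof clarsimp
    fix f p assume f: "f \<in> injections k I" and p: "p \<in> I" "p \<notin> f ` {..<k}"
    have "inj_on (f(k := p)) (insert k {..<k})"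
      using f p by (intro inj_on_fun_updI[THEN inj_on_insert[THEN iffD2, OF conjI]])
        (auto simp: injections_def)
    then show "f(k := p) \<in> injections (Suc k) I"
      using f p by (auto simp: injections_def lessThan_Suc PiE_def extensional_def)
  qed
  show "(\<lambda>f. (restrict f {..<k}, f k)) ` ?T \<subseteq> ?S"
  proof clarify
    fix f assume f: "f \<in> injections (Suc k) I"
    then have inj: "inj_on f (insert k {..<k})" by (simp add: injections_def lessThan_Suc)
    then have "f k \<notin> f ` {..<k}" "inj_on f {..<k}" by auto
    moreover have "restrict f {..<k} ` {..<k} = f ` {..<k}" by auto
    ultimately show "restrict f {..<k} \<in> injections k I \<and> f k \<in> I - restrict f {..<k} ` {..<k}"
      using f by (auto simp: injections_def PiE_def Pi_def)
  qed
qed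

text \<open>
  Multiplying the sum for \<open>k\<close> functions by the power sum of one more function \<open>w\<close> gives the sum for
  \<open>k + 1\<close> functions plus \<open>k\<close> correction terms, in which \<open>w\<close> is multiplied into one of the old ones.
\<close>

lemma (in cring) injection_sum_mem_subring:
  fixes G :: "('i \<Rightarrow> 'a) set"
  assumes B: "subring B R" and I: "finite I"
    and G: "\<And>g p. g \<in> G \<Longrightarrow> p \<in> I \<Longrightarrow> g p \<in> carrier R"
    and G_mult: "\<And>g h. g \<in> G \<Longrightarrow> h \<in> G \<Longrightarrow> \<exists>e\<in>G. \<forall>p\<in>I. e p = g p \<otimes> h p"
    and G_sum: "\<And>g. g \<in> G \<Longrightarrow> (\<Oplus>p\<in>I. g p) \<in> B"
    and g: "\<And>j. j < k \<Longrightarrow> g j \<in> G"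
  shows "(\<Oplus>f\<in>injections k I. \<Otimes>j\<in>{..<k}. g j (f j)) \<in> B"
  using g
\<comment> \<open>\<open>g\<close> stays arbitrary because the correction terms apply the hypothesis
  to the modified family \<open>g(j := e j)\<close>.\<close>
proof (induction k arbitrary: g)
  case 0
  show ?case using subringE(3)[OF B] subringE(1)[OF B] by (simp add: injections_0)
next
  case (Suc k)
  let ?J = "injections k I"
  let ?m = "\<lambda>f. \<Otimes>j\<in>{..<k}. g j (f j)"
  let ?w = "g k"
  have fI: "f j \<in> I" if "f \<in> injections k I" "j < k" for f j
    using that by (auto simp: injections_def)
  have gc: "g j p \<in> carrier R" if "j \<le> k" "p \<in> I" for j p
    using that Suc.prems[of j] G by auto
  have mc: "?m f \<in> carrier R" if "f \<in> ?J" for f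
    by (rule finprod_closed) (use fI[OF that] gc in auto)
  have fin: "finite ?J" using I by (rule finite_injections)
  \<comment> \<open>\<open>G\<close> is closed under products only up to agreement on
    \<open>I\<close>; the choice fixes, for each \<open>j < k\<close>, one member \<open>e j\<close>
    that agrees there with the product of \<open>g j\<close> and \<open>g k\<close>.\<close>
  have "\<forall>j. \<exists>e. j < k \<longrightarrow> e \<in> G \<and> (\<forall>p\<in>I. e p = g j p \<otimes> ?w p)"
    using G_mult Suc.prems by (meson less_Suc_eq lessI)
  then obtain e where e: "\<And>j. j < k \<Longrightarrow> e j \<in> G \<and> (\<forall>p\<in>I. e j p = g j p \<otimes> ?w p)"
    by metis
  have big: "(\<Oplus>f\<in>injections (Suc k) I. \<Otimes>j\<in>{..<Suc k}. g j (f j)) =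
      (\<Oplus>f\<in>?J. \<Oplus>p\<in>I - f ` {..<k}. ?m f \<otimes> ?w p)"
  proof -
    have "(\<Oplus>f\<in>injections (Suc k) I. \<Otimes>j\<in>{..<Suc k}. g j (f j)) =
        (\<Oplus>x\<in>(SIGMA f:?J. I - f ` {..<k}). \<Otimes>j\<in>{..<Suc k}. g j ((\<lambda>(f, p). f(k := p)) x j))"
    proof (subst bij_betw_imp_surj_on[OF injections_Suc, symmetric], rule finsum_reindex)
      show "inj_on (\<lambda>(f, p). f(k := p)) (SIGMA f:?J. I - f ` {..<k})"
        using injections_Suc by (rule bij_betw_imp_inj_on)
    next
      show "(\<lambda>f. \<Otimes>j\<in>{..<Suc k}. g j (f j))
          \<in> (\<lambda>(f, p). f(k := p)) ` (SIGMA f:?J. I - f ` {..<k}) \<rightarrow> carrier R"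
        unfolding bij_betw_imp_surj_on[OF injections_Suc]
      proof (intro Pi_I finprod_closed)
        fix f j assume f: "f \<in> injections (Suc k) I" and j: "j \<in> {..<Suc k}"
        then have "f j \<in> I" unfolding injections_def by blast
        then show "g j (f j) \<in> carrier R" using j by (intro gc) simp_all
      qed
    qed
    also have "\<dots> = (\<Oplus>x\<in>(SIGMA f:?J. I - f ` {..<k}). ?m (fst x) \<otimes> ?w (snd x))"
    proof (rule finsum_cong')
      show "(\<lambda>x. ?m (fst x) \<otimes> ?w (snd x)) \<in> (SIGMA f:?J. I - f ` {..<k}) \<rightarrow> carrier R"
        by (rule Pi_I) (use mc gc in auto)
    next
      fix x assume x: "x \<in> (SIGMA f:?J. I - f ` {..<k})"
      obtain f p where fp: "x = (f, p)" by force
      have fp': "f \<in> ?J" "p \<in> I" using x fp by auto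
      have "(\<Otimes>j\<in>{..<Suc k}. g j ((f(k := p)) j)) = ?w p \<otimes> (\<Otimes>j\<in>{..<k}. g j ((f(k := p)) j))"
        unfolding lessThan_Suc by (subst finprod_insert) (use fp' fI gc in \<open>auto simp: Pi_def\<close>)
      also have "(\<Otimes>j\<in>{..<k}. g j ((f(k := p)) j)) = ?m f"
        by (rule finprod_cong') (use fp' fI gc in auto)
      also have "?w p \<otimes> ?m f = ?m f \<otimes> ?w p" using mc gc fp' by (simp add: m_comm)
      finally show "(\<Otimes>j\<in>{..<Suc k}. g j ((case x of (f, p) \<Rightarrow> f(k := p)) j)) =
          ?m (fst x) \<otimes> ?w (snd x)" by (simp add: fp)
    qed simp
    also have "\<dots> = (\<Oplus>f\<in>?J. \<Oplus>p\<in>I - f ` {..<k}. ?m f \<otimes> ?w p)"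
      by (rule finsum_Sigma[symmetric]) (use fin I mc gc in auto)
    finally show ?thesis .
  qed
  \<comment> \<open>A point of \<open>I\<close> either avoids the image of \<open>f\<close> or
    equals \<open>f j\<close> for exactly one \<open>j < k\<close>, by injectivity. Hence the sum
    over the image can be indexed by \<open>j\<close>.\<close>
  have split: "?m f \<otimes> (\<Oplus>p\<in>I. ?w p) =
      (\<Oplus>p\<in>I - f ` {..<k}. ?m f \<otimes> ?w p) \<oplus> (\<Oplus>j\<in>{..<k}. ?m f \<otimes> ?w (f j))" if f: "f \<in> ?J" for f
  proof -
    have "?m f \<otimes> (\<Oplus>p\<in>I. ?w p) = (\<Oplus>p\<in>I. ?m f \<otimes> ?w p)"
      by (rule finsum_rdistr) (use I mc f gc in auto)
    also have "\<dots> = (\<Oplus>p\<in>(I - f ` {..<k}) \<union> f ` {..<k}. ?m f \<otimes> ?w p)"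
      by (rule finsum_cong') (use fI[OF f] mc f gc in auto)
    also have "\<dots> = (\<Oplus>p\<in>I - f ` {..<k}. ?m f \<otimes> ?w p) \<oplus> (\<Oplus>p\<in>f ` {..<k}. ?m f \<otimes> ?w p)"
      by (rule finsum_Un_disjoint) (use I fI[OF f] mc f gc in auto)
    also have "(\<Oplus>p\<in>f ` {..<k}. ?m f \<otimes> ?w p) = (\<Oplus>j\<in>{..<k}. ?m f \<otimes> ?w (f j))"
      by (rule finsum_reindex) (use fI[OF f] mc f gc in \<open>auto simp: injections_def\<close>)
    finally show ?thesis .
  qed
  \<comment> \<open>The new factor is evaluated at the same point \<open>f j\<close> as the factor
    number \<open>j\<close>, so the two merge into the single value
    \<open>e j (f j)\<close>.\<close>
  have corr: "?m f \<otimes> ?w (f j) = (\<Otimes>i\<in>{..<k}. (g(j := e j)) i (f i))" if f: "f \<in> ?J" and j: "j < k" for f j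
  proof -
    have ins: "{..<k} = insert j ({..<k} - {j})" using j by auto
    let ?r = "\<Otimes>i\<in>{..<k} - {j}. g i (f i)"
    have rc: "?r \<in> carrier R" by (rule finprod_closed) (use fI[OF f] gc in auto)
    have 1: "?m f = g j (f j) \<otimes> ?r"
      by (subst ins, subst finprod_insert) (use fI[OF f] gc j in auto)
    have "(\<Otimes>i\<in>{..<k}. (g(j := e j)) i (f i)) =
        e j (f j) \<otimes> (\<Otimes>i\<in>{..<k} - {j}. (g(j := e j)) i (f i))"
      by (subst ins, subst finprod_insert) (use fI[OF f] gc j e[OF j] G in auto)
    also have "(\<Otimes>i\<in>{..<k} - {j}. (g(j := e j)) i (f i)) = ?r"
      by (rule finprod_cong') (use fI[OF f] gc in auto)
    also have "e j (f j) \<otimes> ?r = g j (f j) \<otimes> ?r \<otimes> ?w (f j)"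
      using e[OF j] fI[OF f j] gc j rc by (simp add: m_ac)
    finally show ?thesis using 1 by simp
  qed
  let ?big = "\<Oplus>f\<in>?J. \<Oplus>p\<in>I - f ` {..<k}. ?m f \<otimes> ?w p"
  let ?corr = "\<Oplus>f\<in>?J. \<Oplus>j\<in>{..<k}. ?m f \<otimes> ?w (f j)"
  have "(\<Oplus>f\<in>?J. ?m f) \<otimes> (\<Oplus>p\<in>I. ?w p) = (\<Oplus>f\<in>?J. ?m f \<otimes> (\<Oplus>p\<in>I. ?w p))"
    by (rule finsum_ldistr) (use fin mc gc in \<open>auto intro!: finsum_closed\<close>)
  also have "\<dots> = (\<Oplus>f\<in>?J. (\<Oplus>p\<in>I - f ` {..<k}. ?m f \<otimes> ?w p) \<oplus> (\<Oplus>j\<in>{..<k}. ?m f \<otimes> ?w (f j)))"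
    by (rule finsum_cong') (use split mc gc fI in \<open>auto intro!: finsum_closed\<close>)
  also have "\<dots> = ?big \<oplus> ?corr"
    by (rule finsum_addf) (use mc gc fI in \<open>auto intro!: finsum_closed\<close>)
  finally have eq: "(\<Oplus>f\<in>?J. ?m f) \<otimes> (\<Oplus>p\<in>I. ?w p) = ?big \<oplus> ?corr" .
  \<comment> \<open>With \<open>j\<close> outermost, each inner sum runs over all injections for one
    fixed family of functions, the shape that the induction hypothesis covers.\<close>
  have "?corr = (\<Oplus>j\<in>{..<k}. \<Oplus>f\<in>?J. ?m f \<otimes> ?w (f j))"
  proof -
    have "?corr = (\<Oplus>x\<in>?J \<times> {..<k}. ?m (fst x) \<otimes> ?w (fst x (snd x)))"
      by (rule finsum_Sigma) (use fin mc gc fI in auto)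
    also have "?J \<times> {..<k} = prod.swap ` ({..<k} \<times> ?J)" by force
    also have "(\<Oplus>x\<in>prod.swap ` ({..<k} \<times> ?J). ?m (fst x) \<otimes> ?w (fst x (snd x))) =
        (\<Oplus>x\<in>{..<k} \<times> ?J. ?m (fst (prod.swap x)) \<otimes> ?w (fst (prod.swap x) (snd (prod.swap x))))"
      by (rule finsum_reindex) (use mc gc fI in auto)
    also have "\<dots> = (\<Oplus>x\<in>{..<k} \<times> ?J. ?m (snd x) \<otimes> ?w (snd x (fst x)))"
      by (rule finsum_cong') (use mc gc fI in auto)
    also have "\<dots> = (\<Oplus>j\<in>{..<k}. \<Oplus>f\<in>?J. ?m f \<otimes> ?w (f j))"
      by (rule finsum_Sigma[symmetric]) (use fin mc gc fI in auto)
    finally show ?thesis .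
  qed
  also have "\<dots> \<in> B"
  proof (rule subring_finsum_closed[OF B])
    fix j assume j: "j \<in> {..<k}"
    have "(\<Oplus>f\<in>?J. ?m f \<otimes> ?w (f j)) = (\<Oplus>f\<in>?J. \<Otimes>i\<in>{..<k}. (g(j := e j)) i (f i))"
    proof (rule finsum_cong')
      show "(\<lambda>f. \<Otimes>i\<in>{..<k}. (g(j := e j)) i (f i)) \<in> ?J \<rightarrow> carrier R"
      proof (rule Pi_I)
        fix f assume f: "f \<in> ?J"
        have "?m f \<otimes> ?w (f j) \<in> carrier R" using mc[OF f] gc fI[OF f] j by simp
        then show "(\<Otimes>i\<in>{..<k}. (g(j := e j)) i (f i)) \<in> carrier R" using corr[OF f, of j] j by simp
      qed
    qed (use corr j in auto)
    also have "\<dots> \<in> B" by (rule Suc.IH) (use Suc.prems e j in auto)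
    finally show "(\<Oplus>f\<in>?J. ?m f \<otimes> ?w (f j)) \<in> B" .
  qed
  finally have corrB: "?corr \<in> B" .
  have bigc: "?big \<in> carrier R" by (intro finsum_closed Pi_I) (use mc gc in auto)
  have JB: "(\<Oplus>f\<in>?J. ?m f) \<in> B" by (rule Suc.IH) (use Suc.prems in auto)
  have wB: "(\<Oplus>p\<in>I. ?w p) \<in> B" by (rule G_sum) (use Suc.prems in auto)
  have prodB: "?big \<oplus> ?corr \<in> B"
    unfolding eq[symmetric] using JB wB by (rule subringE(6)[OF B])
  \<comment> \<open>Solving for the sum over \<open>k + 1\<close> indices takes a subtraction only,
    which stays inside a subring.\<close>
  have "?big = (?big \<oplus> ?corr) \<oplus> (\<ominus> ?corr)"
    using bigc subsetD[OF subringE(1)[OF B] corrB] by (simp add: a_assoc r_neg)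
  also have "\<dots> \<in> B" using prodB corrB subringE(5,7)[OF B] by blast
  finally show ?case unfolding big .
qed

section \<open>The ring of tensors\<close>

text \<open>In the nested \<open>frag_extend\<close> that defines products of formal sums, the
  second factor sits inside the function being extended. Additivity in that factor is additivity in
  the function.\<close>

lemma frag_extend_fun_diff:
  "frag_extend (\<lambda>x. f x - g x) c = frag_extend f c - frag_extend g c"
  using subset_UNIV[of "Poly_Mapping.keys c"]
  by (induction c rule: frag_induction) (auto simp: frag_extend_diff)

text \<open>The tensor power carries a scalar action and the quotient ring does not, so they are
  records of different types. The ring axioms pass between them through the agreement of carrier and
  operations.\<close>

lemma cring_if_eq_operations:
  assumes "cring Q" "carrier T = carrier Q" "mult T = mult Q" "one T = one Q"
    "zero T = zero Q" "add T = add Q"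
  shows "cring T"
proof -
  interpret cring Q by fact
  show ?thesis
    by (intro cringI abelian_groupI comm_monoidI)
      (auto simp: assms(2-) a_ac m_ac l_distr r_distr intro: l_neg)
qed

locale algebra_power =
  fixes A :: "('a, 'k) ring_scheme" and R :: "('a, 'b, 'm) module_scheme" and n :: nat
  assumes alg: "algebra A R"
begin

abbreviation "F \<equiv> tuple_ring R n"
abbreviation "I \<equiv> tensor_ideal A R n"
abbreviation "T \<equiv> tensor_power A R n"
abbreviation "pure \<equiv> pure_tensor A R n"

sublocale R: cring R
  using alg by (rule algebra.M_cring)

lemma smult_closed: "a \<in> carrier A \<Longrightarrow> u \<in> carrier R \<Longrightarrow> a \<odot>\<^bsub>R\<^esub> u \<in> carrier R"
  by (rule module.smult_closed[OF algebra.axioms(1)[OF alg]])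

lemma smult_mult: "a \<in> carrier A \<Longrightarrow> u \<in> carrier R \<Longrightarrow> v \<in> carrier R \<Longrightarrow>
    (a \<odot>\<^bsub>R\<^esub> u) \<otimes>\<^bsub>R\<^esub> v = a \<odot>\<^bsub>R\<^esub> (u \<otimes>\<^bsub>R\<^esub> v)"
  using alg by (simp add: algebra.smult_assoc2)

section \<open>Formal combinations of tuples\<close>

lemma tuple_ring_simps:
  "c \<in> carrier F \<longleftrightarrow> Poly_Mapping.keys c \<subseteq> tuples R n"
  "c \<oplus>\<^bsub>F\<^esub> d = c + d"
  "\<zero>\<^bsub>F\<^esub> = 0"
  "\<one>\<^bsub>F\<^esub> = frag_of (\<lambda>i\<in>{..<n}. \<one>\<^bsub>R\<^esub>)"
  by (simp_all add: tuple_ring_def)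

lemma tuple_ring_mult_of:
  "frag_of x \<otimes>\<^bsub>F\<^esub> frag_of y = frag_of (tuple_mult R n x y)"
  by (simp add: tuple_ring_def)

lemma tuple_ring_mult_0: "0 \<otimes>\<^bsub>F\<^esub> c = 0" "c \<otimes>\<^bsub>F\<^esub> 0 = 0"
  by (simp_all add: tuple_ring_def frag_extend_eq_0)

lemma tuple_ring_mult_diff:
  "(c - d) \<otimes>\<^bsub>F\<^esub> e = c \<otimes>\<^bsub>F\<^esub> e - d \<otimes>\<^bsub>F\<^esub> e"
  "e \<otimes>\<^bsub>F\<^esub> (c - d) = e \<otimes>\<^bsub>F\<^esub> c - e \<otimes>\<^bsub>F\<^esub> d"
  by (simp_all add: tuple_ring_def frag_extend_diff frag_extend_fun_diff)

lemma tuple_ring_mult_add: "(c + d) \<otimes>\<^bsub>F\<^esub> e = c \<otimes>\<^bsub>F\<^esub> e + d \<otimes>\<^bsub>F\<^esub> e"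
  "e \<otimes>\<^bsub>F\<^esub> (c + d) = e \<otimes>\<^bsub>F\<^esub> c + e \<otimes>\<^bsub>F\<^esub> d"
  using tuple_ring_mult_diff(1)[of "c + d" d e] tuple_ring_mult_diff(2)[of e "c + d" d] by simp_all

lemma tuple_mult_closed:
  "x \<in> tuples R n \<Longrightarrow> y \<in> tuples R n \<Longrightarrow> tuple_mult R n x y \<in> tuples R n"
  by (auto simp: tuples_def tuple_mult_def)

lemma frag_of_closed: "x \<in> tuples R n \<Longrightarrow> frag_of x \<in> carrier F"
  by (simp add: tuple_ring_simps)

lemma tuple_ring_diff_closed: "c \<in> carrier F \<Longrightarrow> d \<in> carrier F \<Longrightarrow> c - d \<in> carrier F"
  using keys_diff[of c d] by (auto simp: tuple_ring_simps)

text \<open>Closure under differences covers negatives and sums at once, because \<open>0\<close> is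
  among the base cases.\<close>

lemma tuple_ring_induct [consumes 1, case_names zero of diff]:
  assumes "c \<in> carrier F" "P 0" "\<And>x. x \<in> tuples R n \<Longrightarrow> P (frag_of x)"
    "\<And>c d. P c \<Longrightarrow> P d \<Longrightarrow> P (c - d)"
  shows "P c"
  using assms(1) unfolding tuple_ring_simps
  by (induction c rule: frag_induction) (use assms in auto)

text \<open>Products are biadditive, so an induction over each argument reduces the claim to two
  tuples. The ring laws below are reduced to componentwise laws of \<open>R\<close> in the same
  manner.\<close>

lemma tuple_ring_mult_closed:
  assumes "c \<in> carrier F" "d \<in> carrier F"
  shows "c \<otimes>\<^bsub>F\<^esub> d \<in> carrier F"
  using assms(1)
proof (induction rule: tuple_ring_induct)
  case (of x)
  show ?case
    using assms(2)
    by (induction rule: tuple_ring_induct)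
      (use of in \<open>auto simp: tuple_ring_mult_0 tuple_ring_mult_of tuple_ring_mult_diff
        frag_of_closed tuple_mult_closed tuple_ring_diff_closed, simp add: tuple_ring_simps\<close>)
qed (auto simp: tuple_ring_mult_0 tuple_ring_mult_diff tuple_ring_diff_closed, simp add: tuple_ring_simps)

lemma tuple_ring_mult_comm:
  assumes "c \<in> carrier F" "d \<in> carrier F"
  shows "c \<otimes>\<^bsub>F\<^esub> d = d \<otimes>\<^bsub>F\<^esub> c"
  using assms(1)
proof (induction rule: tuple_ring_induct)
  case (of x)
  have comm: "tuple_mult R n x y = tuple_mult R n y x" if "y \<in> tuples R n" for y
    using of that by (auto simp: tuples_def tuple_mult_def restrict_def fun_eq_iff
      intro!: R.m_comm)
  show ?case
    using assms(2)
    by (induction rule: tuple_ring_induct)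
      (simp_all add: tuple_ring_mult_0 tuple_ring_mult_of tuple_ring_mult_diff comm)
qed (simp_all add: tuple_ring_mult_0 tuple_ring_mult_diff)

lemma tuple_ring_mult_assoc:
  assumes "c \<in> carrier F" "d \<in> carrier F" "e \<in> carrier F"
  shows "c \<otimes>\<^bsub>F\<^esub> d \<otimes>\<^bsub>F\<^esub> e = c \<otimes>\<^bsub>F\<^esub> (d \<otimes>\<^bsub>F\<^esub> e)"
  using assms(1)
proof (induction rule: tuple_ring_induct)
  case x: (of x)
  show ?case
    using assms(2)
  proof (induction rule: tuple_ring_induct)
    case y: (of y)
    have assoc: "tuple_mult R n (tuple_mult R n x y) z = tuple_mult R n x (tuple_mult R n y z)"
      if "z \<in> tuples R n" for z
      using x y that by (auto simp: tuples_def tuple_mult_def restrict_def fun_eq_iff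
        intro!: R.m_assoc)
    show ?case
      using assms(3)
      by (induction rule: tuple_ring_induct)
        (simp_all add: tuple_ring_mult_0 tuple_ring_mult_of tuple_ring_mult_diff assoc)
  qed (simp_all add: tuple_ring_mult_0 tuple_ring_mult_diff)
qed (simp_all add: tuple_ring_mult_0 tuple_ring_mult_diff)

lemma tuple_ring_one_mult:
  assumes "c \<in> carrier F"
  shows "\<one>\<^bsub>F\<^esub> \<otimes>\<^bsub>F\<^esub> c = c"
  using assms
proof (induction rule: tuple_ring_induct)
  case (of x)
  then have "tuple_mult R n (\<lambda>i\<in>{..<n}. \<one>\<^bsub>R\<^esub>) x = x"
    by (auto simp: tuples_def tuple_mult_def fun_eq_iff PiE_def extensional_def Pi_def)
  then show ?case by (simp add: tuple_ring_simps tuple_ring_mult_of)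
qed (simp_all add: tuple_ring_mult_0 tuple_ring_mult_diff)

sublocale F: cring F
proof (intro cringI abelian_groupI comm_monoidI)
  fix c d assume "c \<in> carrier F" "d \<in> carrier F"
  then show "c \<oplus>\<^bsub>F\<^esub> d \<in> carrier F"
    using keys_add[of c d] by (auto simp: tuple_ring_simps)
next
  fix c assume "c \<in> carrier F"
  then show "\<exists>d\<in>carrier F. d \<oplus>\<^bsub>F\<^esub> c = \<zero>\<^bsub>F\<^esub>"
    by (intro bexI[where x = "- c"]) (auto simp: tuple_ring_simps)
next
  show "\<one>\<^bsub>F\<^esub> \<in> carrier F" by (auto simp: tuple_ring_simps tuples_def)
qed (auto simp: tuple_ring_mult_closed tuple_ring_mult_assoc tuple_ring_one_mult
  tuple_ring_mult_add(1) tuple_ring_simps(2,3) add_ac intro: tuple_ring_mult_comm,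
  simp_all add: tuple_ring_simps)

lemma tuple_ring_minus: "c \<in> carrier F \<Longrightarrow> \<ominus>\<^bsub>F\<^esub> c = - c"
  by (rule F.minus_equality) (auto simp: tuple_ring_simps)

lemma tuple_ring_minus_eq_diff: "c \<in> carrier F \<Longrightarrow> d \<in> carrier F \<Longrightarrow> c \<ominus>\<^bsub>F\<^esub> d = c - d"
  by (simp add: a_minus_def tuple_ring_minus tuple_ring_simps(2))

section \<open>The ideal of tensor relations\<close>

lemma tuple_upd_closed:
  "x \<in> tuples R n \<Longrightarrow> i < n \<Longrightarrow> u \<in> carrier R \<Longrightarrow> x(i := u) \<in> tuples R n"
  by (auto simp: tuples_def PiE_def extensional_def)

lemma tuple_in_carrier: "x \<in> tuples R n \<Longrightarrow> i < n \<Longrightarrow> x i \<in> carrier R"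
  by (auto simp: tuples_def)

lemma tensor_rels_cases [consumes 1, case_names add smult]:
  assumes "r \<in> tensor_rels A R n"
  obtains x i u v where "x \<in> tuples R n" "i < n" "u \<in> carrier R" "v \<in> carrier R"
      "r = frag_of (x(i := u \<oplus>\<^bsub>R\<^esub> v)) - frag_of (x(i := u)) - frag_of (x(i := v))"
    | x i j a where "x \<in> tuples R n" "i < n" "j < n" "a \<in> carrier A"
      "r = frag_of (x(i := a \<odot>\<^bsub>R\<^esub> x i)) - frag_of (x(j := a \<odot>\<^bsub>R\<^esub> x j))"
  using assms unfolding tensor_rels_def by blast

lemma tensor_rels_addI:
  assumes "x \<in> tuples R n" "i < n" "u \<in> carrier R" "v \<in> carrier R"
  shows "frag_of (x(i := u \<oplus>\<^bsub>R\<^esub> v)) - frag_of (x(i := u)) - frag_of (x(i := v)) \<in> tensor_rels A R n"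
  using assms unfolding tensor_rels_def by blast

lemma tensor_rels_smultI:
  assumes "x \<in> tuples R n" "i < n" "j < n" "a \<in> carrier A"
  shows "frag_of (x(i := a \<odot>\<^bsub>R\<^esub> x i)) - frag_of (x(j := a \<odot>\<^bsub>R\<^esub> x j)) \<in> tensor_rels A R n"
  using assms unfolding tensor_rels_def by blast

lemma tensor_rels_subset: "tensor_rels A R n \<subseteq> carrier F"
proof
  fix r assume "r \<in> tensor_rels A R n"
  then show "r \<in> carrier F"
    by (cases rule: tensor_rels_cases)
      (auto intro!: tuple_ring_diff_closed frag_of_closed tuple_upd_closed smult_closed
        simp: tuple_in_carrier)
qed

lemma tensor_ideal_subgroup: "subgroup I (add_monoid F)"
  unfolding tensor_ideal_def
  by (rule F.add.generate_is_subgroup) (use tensor_rels_subset in simp)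

lemma tensor_ideal_subset: "I \<subseteq> carrier F"
  using subgroup.subset[OF tensor_ideal_subgroup] by simp

lemma tensor_ideal_add: "c \<in> I \<Longrightarrow> d \<in> I \<Longrightarrow> c + d \<in> I"
  using subgroup.m_closed[OF tensor_ideal_subgroup] by (simp add: tuple_ring_simps)

lemma tensor_ideal_minus: "c \<in> I \<Longrightarrow> - c \<in> I"
  using subgroup.m_inv_closed[OF tensor_ideal_subgroup, of c] tensor_ideal_subset
  unfolding a_inv_def[symmetric] by (auto simp: tuple_ring_minus)

lemma tensor_ideal_zero: "0 \<in> I"
  using subgroup.one_closed[OF tensor_ideal_subgroup] by (simp add: tuple_ring_simps)

lemma tensor_ideal_diff: "c \<in> I \<Longrightarrow> d \<in> I \<Longrightarrow> c - d \<in> I"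
  using tensor_ideal_add[of c "- d"] tensor_ideal_minus by simp

lemma tensor_ideal_of_rel: "r \<in> tensor_rels A R n \<Longrightarrow> r \<in> I"
  unfolding tensor_ideal_def by (rule generate.incl)

text \<open>Respecting differences implies respecting \<open>0\<close>, negatives and sums, so it
  suffices to control the generators. The maps in question are multiplication by a fixed element and
  permutation of the factors.\<close>

lemma tensor_ideal_preserved:
  fixes h :: "((nat \<Rightarrow> 'b) \<Rightarrow>\<^sub>0 int) \<Rightarrow> ((nat \<Rightarrow> 'b) \<Rightarrow>\<^sub>0 int)"
  assumes diff: "\<And>c d. h (c - d) = h c - h d"
    and rels: "\<And>r. r \<in> tensor_rels A R n \<Longrightarrow> h r \<in> I"
    and "c \<in> I"
  shows "h c \<in> I"
proof -
  have h0: "h 0 = 0" using diff[of 0 0] by simp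
  have minus: "h (- c) = - h c" for c using diff[of 0 c] h0 by simp
  have add: "h (c + d) = h c + h d" for c d using diff[of c "- d"] minus by simp
  from \<open>c \<in> I\<close> have "c \<in> generate (add_monoid F) (tensor_rels A R n)"
    by (simp add: tensor_ideal_def)
  then show ?thesis
  proof (induction rule: generate.induct)
    case one
    then show ?case using h0 tensor_ideal_zero by (simp add: tuple_ring_simps)
  next
    case (incl r)
    then show ?case by (rule rels)
  next
    case (inv r)
    then have "inv\<^bsub>add_monoid F\<^esub> r = - r"
      using tensor_rels_subset tuple_ring_minus[of r] unfolding a_inv_def by auto
    then show ?case using tensor_ideal_minus[OF rels[OF inv]] by (simp only: minus)
  next
    case (eng c d)
    then show ?case using tensor_ideal_add by (simp add: add tuple_ring_simps)
  qed
qed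

lemma tuple_mult_upd:
  assumes "i < n"
  shows "tuple_mult R n x (y(i := u)) = (tuple_mult R n x y)(i := x i \<otimes>\<^bsub>R\<^esub> u)"
  using assms by (auto simp: tuple_mult_def)

text \<open>A tuple times a relation is again a relation of the same kind: distributivity in
  \<open>R\<close> handles the additive ones, and for the others the scalar is pulled out of the
  product in \<open>R\<close>. This turns the generated subgroup into an ideal.\<close>

lemma mult_rel_mem:
  assumes "c \<in> carrier F" and r: "r \<in> tensor_rels A R n"
  shows "c \<otimes>\<^bsub>F\<^esub> r \<in> I"
  using assms(1)
proof (induction rule: tuple_ring_induct)
  case zero
  then show ?case by (simp add: tuple_ring_mult_0 tensor_ideal_zero)
next
  case (diff c d)
  then show ?case by (simp add: tuple_ring_mult_diff tensor_ideal_diff)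
next
  case (of y)
  from r show ?case
  proof (cases rule: tensor_rels_cases)
    case (add x i u v)
    have yi: "y i \<in> carrier R" using of add by (simp add: tuple_in_carrier)
    show ?thesis
      unfolding add(5) tuple_ring_mult_diff tuple_ring_mult_of tuple_mult_upd[OF add(2)]
      using add yi of
      by (auto intro!: tensor_ideal_of_rel tensor_rels_addI tuple_mult_closed simp: R.r_distr)
  next
    case (smult x i j a)
    let ?z = "tuple_mult R n y x"
    have z: "?z i = y i \<otimes>\<^bsub>R\<^esub> x i" "?z j = y j \<otimes>\<^bsub>R\<^esub> x j"
      using smult by (auto simp: tuple_mult_def)
    have c: "y i \<in> carrier R" "y j \<in> carrier R" "x i \<in> carrier R" "x j \<in> carrier R"
      using of smult by (simp_all add: tuple_in_carrier)
    have eq: "y k \<otimes>\<^bsub>R\<^esub> (a \<odot>\<^bsub>R\<^esub> x k) = a \<odot>\<^bsub>R\<^esub> ?z k" if "k = i \<or> k = j" for k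
      using that c z smult(4) smult_mult[of a "x k" "y k"]
      by (auto simp: R.m_comm smult_closed)
    show ?thesis
      unfolding smult(5) tuple_ring_mult_diff tuple_ring_mult_of tuple_mult_upd[OF smult(2)]
        tuple_mult_upd[OF smult(3)]
      using eq tensor_rels_smultI[OF tuple_mult_closed[OF of smult(1)] smult(2-4)]
      by (auto intro!: tensor_ideal_of_rel)
  qed
qed

sublocale I: ideal I F
proof (rule idealI[OF F.ring_axioms tensor_ideal_subgroup])
  fix c d assume c: "c \<in> I" and d: "d \<in> carrier F"
  show 1: "d \<otimes>\<^bsub>F\<^esub> c \<in> I"
    by (rule tensor_ideal_preserved[where h = "\<lambda>c. d \<otimes>\<^bsub>F\<^esub> c", OF tuple_ring_mult_diff(2)])
      (use c d mult_rel_mem in auto)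
  show "c \<otimes>\<^bsub>F\<^esub> d \<in> I"
    using 1 tuple_ring_mult_comm[OF subsetD[OF tensor_ideal_subset c] d] by simp
qed

section \<open>The quotient ring, pure tensors and co-projections\<close>

lemma tensor_power_simps:
  "carrier T = carrier (F Quot I)" "mult T = mult (F Quot I)" "one T = one (F Quot I)"
  "zero T = zero (F Quot I)" "add T = add (F Quot I)"
  "smult T = (\<lambda>a t. coproj A R n 0 (a \<odot>\<^bsub>R\<^esub> \<one>\<^bsub>R\<^esub>) \<otimes>\<^bsub>T\<^esub> t)"
  by (simp_all add: tensor_power_def Let_def)

sublocale T: cring T
  using I.quotient_is_cring[OF F.is_cring] tensor_power_simps(1-5) by (rule cring_if_eq_operations)

abbreviation "cls c \<equiv> I +>\<^bsub>F\<^esub> c"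

lemma cls_ring_hom: "(\<lambda>c. cls c) \<in> ring_hom F T"
  using I.rcos_ring_hom by (auto simp: ring_hom_def tensor_power_simps)

lemma tensor_carrier: "carrier T = cls ` carrier F"
  by (auto simp: tensor_power_simps FactRing_def A_RCOSETS_def')

lemma cls_closed: "c \<in> carrier F \<Longrightarrow> cls c \<in> carrier T"
  by (simp add: tensor_carrier)

lemma cls_mult: "c \<in> carrier F \<Longrightarrow> d \<in> carrier F \<Longrightarrow> cls c \<otimes>\<^bsub>T\<^esub> cls d = cls (c \<otimes>\<^bsub>F\<^esub> d)"
  using ring_hom_mult[OF cls_ring_hom] by simp

lemma cls_add: "c \<in> carrier F \<Longrightarrow> d \<in> carrier F \<Longrightarrow> cls c \<oplus>\<^bsub>T\<^esub> cls d = cls (c + d)"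
  using ring_hom_add[OF cls_ring_hom] by (simp add: tuple_ring_simps)

lemma cls_one: "\<one>\<^bsub>T\<^esub> = cls \<one>\<^bsub>F\<^esub>"
  using ring_hom_one[OF cls_ring_hom] by simp

lemma cls_zero: "\<zero>\<^bsub>T\<^esub> = cls 0"
  using ring_hom_zero[OF cls_ring_hom F.ring_axioms T.ring_axioms] by (simp add: tuple_ring_simps)

lemma cls_diff:
  assumes "c \<in> carrier F" "d \<in> carrier F"
  shows "cls (c - d) = cls c \<ominus>\<^bsub>T\<^esub> cls d"
proof -
  have "cls (c - d) \<oplus>\<^bsub>T\<^esub> cls d = cls c" using assms by (simp add: cls_add tuple_ring_diff_closed)
  then show ?thesis
    using assms cls_closed tuple_ring_diff_closed
    by (metis T.a_assoc T.a_inv_closed T.minus_eq T.r_neg T.r_zero)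
qed

lemma cls_eq_iff: "c \<in> carrier F \<Longrightarrow> d \<in> carrier F \<Longrightarrow> cls c = cls d \<longleftrightarrow> c - d \<in> I"
  using F.quotient_eq_iff_same_a_r_cos[OF I.ideal_axioms, of c d]
  by (simp add: tuple_ring_minus_eq_diff)

lemma pure_eq_cls: "pure x = cls (frag_of (restrict x {..<n}))"
  by (simp add: pure_tensor_def)

lemma restrict_tuple: "(\<And>i. i < n \<Longrightarrow> x i \<in> carrier R) \<Longrightarrow> restrict x {..<n} \<in> tuples R n"
  by (auto simp: tuples_def)

lemma pure_closed: "(\<And>i. i < n \<Longrightarrow> x i \<in> carrier R) \<Longrightarrow> pure x \<in> carrier T"
  by (simp add: pure_eq_cls cls_closed frag_of_closed restrict_tuple)

lemma pure_cong: "(\<And>i. i < n \<Longrightarrow> x i = y i) \<Longrightarrow> pure x = pure y"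
  unfolding pure_eq_cls by (metis lessThan_iff restrict_ext)

lemma pure_mult:
  assumes "\<And>i. i < n \<Longrightarrow> x i \<in> carrier R" "\<And>i. i < n \<Longrightarrow> y i \<in> carrier R"
  shows "pure x \<otimes>\<^bsub>T\<^esub> pure y = pure (\<lambda>i. x i \<otimes>\<^bsub>R\<^esub> y i)"
proof -
  have "tuple_mult R n (restrict x {..<n}) (restrict y {..<n}) = (\<lambda>i\<in>{..<n}. x i \<otimes>\<^bsub>R\<^esub> y i)"
    by (auto simp: tuple_mult_def)
  then show ?thesis
    using assms by (simp add: pure_eq_cls cls_mult frag_of_closed restrict_tuple tuple_ring_mult_of)
qed

lemma pure_one: "pure (\<lambda>_. \<one>\<^bsub>R\<^esub>) = \<one>\<^bsub>T\<^esub>"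
  by (simp add: pure_eq_cls cls_one tuple_ring_simps)

text \<open>Pure tensors generate the tensor power as an additive group; scalars need no case of
  their own because they can be absorbed into a factor.\<close>

lemma tensor_induct [consumes 1, case_names zero pure diff]:
  assumes "t \<in> carrier T" and zero: "P \<zero>\<^bsub>T\<^esub>"
    and pure: "\<And>x. (\<And>i. i < n \<Longrightarrow> x i \<in> carrier R) \<Longrightarrow> P (pure x)"
    and diff: "\<And>t u. t \<in> carrier T \<Longrightarrow> u \<in> carrier T \<Longrightarrow> P t \<Longrightarrow> P u \<Longrightarrow> P (t \<ominus>\<^bsub>T\<^esub> u)"
  shows "P t"
proof -
  obtain c where c: "c \<in> carrier F" "t = cls c" using assms(1) by (auto simp: tensor_carrier)
  \<comment> \<open>Membership in the carrier is carried along because the difference case needs it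
    for both classes.\<close>
  from c(1) have "c \<in> carrier F \<and> P (cls c)"
  proof (induction rule: tuple_ring_induct)
    case zero
    then show ?case using assms(2) by (simp add: cls_zero tuple_ring_simps)
  next
    case (of x)
    then have "restrict x {..<n} = x" by (auto simp: tuples_def PiE_restrict)
    then show ?case
      using of pure[of x] by (simp add: pure_eq_cls frag_of_closed tuple_in_carrier)
  next
    case (diff c d)
    then show ?case using assms(4) by (simp add: cls_diff cls_closed tuple_ring_diff_closed)
  qed
  then show ?thesis using c by simp
qed

lemma pure_smult_move:
  assumes "\<And>i. i < n \<Longrightarrow> x i \<in> carrier R" "i < n" "j < n" "a \<in> carrier A"
  shows "pure (x(i := a \<odot>\<^bsub>R\<^esub> x i)) = pure (x(j := a \<odot>\<^bsub>R\<^esub> x j))"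
proof -
  let ?x = "restrict x {..<n}"
  have x: "?x \<in> tuples R n" using assms(1) by (rule restrict_tuple)
  have eq: "restrict (x(k := a \<odot>\<^bsub>R\<^esub> x k)) {..<n} = ?x(k := a \<odot>\<^bsub>R\<^esub> ?x k)" if "k < n" for k
    using that by auto
  have "?x(k := a \<odot>\<^bsub>R\<^esub> ?x k) \<in> tuples R n" if "k < n" for k
    using that x assms by (intro tuple_upd_closed smult_closed) (auto intro: tuple_in_carrier)
  then show ?thesis
    using assms tensor_ideal_of_rel[OF tensor_rels_smultI[OF x assms(2-4)]]
    by (simp add: pure_eq_cls eq cls_eq_iff frag_of_closed del: restrict_apply)
qed

lemma coproj_closed: "z \<in> carrier R \<Longrightarrow> coproj A R n p z \<in> carrier T"
  unfolding coproj_def by (rule pure_closed) auto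

lemma coproj_mult:
  assumes "z \<in> carrier R" "w \<in> carrier R"
  shows "coproj A R n p z \<otimes>\<^bsub>T\<^esub> coproj A R n p w = coproj A R n p (z \<otimes>\<^bsub>R\<^esub> w)"
  unfolding coproj_def using assms by (simp add: pure_mult) (rule pure_cong, simp)

text \<open>This is the scalar relation applied to the tuple of ones; it makes the action through
  factor \<open>0\<close> independent of the chosen factor.\<close>

lemma coproj_scalar:
  assumes "p < n" "q < n" "a \<in> carrier A"
  shows "coproj A R n p (a \<odot>\<^bsub>R\<^esub> \<one>\<^bsub>R\<^esub>) = coproj A R n q (a \<odot>\<^bsub>R\<^esub> \<one>\<^bsub>R\<^esub>)"
proof -
  have "coproj A R n k (a \<odot>\<^bsub>R\<^esub> \<one>\<^bsub>R\<^esub>) = pure ((\<lambda>_. \<one>\<^bsub>R\<^esub>)(k := a \<odot>\<^bsub>R\<^esub> \<one>\<^bsub>R\<^esub>))" for k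
    unfolding coproj_def by (rule pure_cong) auto
  then show ?thesis using pure_smult_move[of "\<lambda>_. \<one>\<^bsub>R\<^esub>" p q a] assms by simp
qed

lemma pure_eq_finprod:
  assumes x: "\<And>i. i < n \<Longrightarrow> x i \<in> carrier R"
  shows "pure x = (\<Otimes>\<^bsub>T\<^esub>p\<in>{..<n}. coproj A R n p (x p))"
proof -
  \<comment> \<open>The factors are filled in one at a time: the intermediate tensor has the entries
    of \<open>x\<close> below \<open>m\<close> and \<open>1\<close> from \<open>m\<close>
    on.\<close>
  have "pure (\<lambda>i. if i < m then x i else \<one>\<^bsub>R\<^esub>) = (\<Otimes>\<^bsub>T\<^esub>p\<in>{..<m}. coproj A R n p (x p))" if "m \<le> n" for m
    using that
  proof (induction m)
    case 0
    then show ?case by (simp add: pure_one)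
  next
    case (Suc m)
    have "pure (\<lambda>i. if i < Suc m then x i else \<one>\<^bsub>R\<^esub>) =
        coproj A R n m (x m) \<otimes>\<^bsub>T\<^esub> pure (\<lambda>i. if i < m then x i else \<one>\<^bsub>R\<^esub>)"
      unfolding coproj_def using x Suc.prems
      by (simp add: pure_mult) (rule pure_cong, auto simp: less_Suc_eq)
    also have "\<dots> = (\<Otimes>\<^bsub>T\<^esub>p\<in>{..<Suc m}. coproj A R n p (x p))"
      unfolding lessThan_Suc
      by (subst T.finprod_insert) (use Suc x in \<open>auto intro!: coproj_closed\<close>)
    finally show ?case .
  qed
  from this[of n] show ?thesis by (simp add: pure_cong[of "\<lambda>i. if i < n then x i else \<one>\<^bsub>R\<^esub>" x])
qed

end

section \<open>Permutation of the factors and symmetric tensors\<close>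

text \<open>The notation \<open>inv\<close> is taken by inverses in groups.\<close>

abbreviation inv_fun :: "('c \<Rightarrow> 'd) \<Rightarrow> 'd \<Rightarrow> 'c"
  where "inv_fun \<equiv> inv_into UNIV"

lemma bij_betw_inv_permutations:
  "bij_betw inv_fun {\<sigma>. \<sigma> permutes S} {\<sigma>. \<sigma> permutes S}"
  by (rule bij_betw_byWitness[where f' = inv_fun]) (auto simp: permutes_inv_inv permutes_inv)

lemma bij_betw_comp_permutations:
  assumes "\<tau> permutes S"
  shows "bij_betw (\<lambda>\<sigma>. \<sigma> \<circ> \<tau>) {\<sigma>. \<sigma> permutes S} {\<sigma>. \<sigma> permutes S}"
  by (rule bij_betw_byWitness[where f' = "\<lambda>\<sigma>. \<sigma> \<circ> inv_fun \<tau>"])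
    (auto simp: comp_assoc permutes_inv_o[OF assms] intro: permutes_compose permutes_inv assms)

text \<open>Both sides have the same values on \<open>{..<n}\<close> and differ in the default
  outside it: the identity for permutations, \<open>undefined\<close> for extensional functions.
  Surjectivity of an injection is the finiteness of \<open>{..<n}\<close>.\<close>

lemma bij_betw_permutations_injections:
  "bij_betw (\<lambda>\<sigma>. restrict \<sigma> {..<n}) {\<sigma>. \<sigma> permutes {..<n}} (injections n {..<n})"
proof (rule bij_betw_byWitness[where f' = "\<lambda>f i. if i < n then f i else i"])
  show "\<forall>\<sigma>\<in>{\<sigma>. \<sigma> permutes {..<n}}. (\<lambda>i. if i < n then restrict \<sigma> {..<n} i else i) = \<sigma>"
    by (auto simp: fun_eq_iff permutes_def)
  show "\<forall>f\<in>injections n {..<n}. restrict (\<lambda>i. if i < n then f i else i) {..<n} = f"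
    by (auto simp: injections_def fun_eq_iff PiE_def extensional_def)
  show "(\<lambda>\<sigma>. restrict \<sigma> {..<n}) ` {\<sigma>. \<sigma> permutes {..<n}} \<subseteq> injections n {..<n}"
  proof clarify
    fix \<sigma> assume \<sigma>: "\<sigma> permutes {..<n}"
    then have "\<sigma> i < n" if "i < n" for i using permutes_in_image[OF \<sigma>, of i] that by simp
    then show "restrict \<sigma> {..<n} \<in> injections n {..<n}"
      using permutes_inj_on[OF \<sigma>] by (auto simp: injections_def)
  qed
  show "(\<lambda>f i. if i < n then f i else i) ` injections n {..<n} \<subseteq> {\<sigma>. \<sigma> permutes {..<n}}"
  proof clarify
    fix f assume f: "f \<in> injections n {..<n}"
    then have inj: "inj_on f {..<n}" and sub: "f ` {..<n} \<subseteq> {..<n}" by (auto simp: injections_def)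
    have "bij_betw f {..<n} {..<n}"
      using inj endo_inj_surj[OF finite_lessThan sub inj] by (simp add: bij_betw_def)
    then have "bij_betw (\<lambda>i. if i < n then f i else i) {..<n} {..<n}"
      by (subst bij_betw_cong[where g = f]) auto
    then show "(\<lambda>i. if i < n then f i else i) permutes {..<n}"
      by (rule bij_imp_permutes) simp
  qed
qed

context algebra_power
begin

abbreviation "perms \<equiv> {\<sigma>. \<sigma> permutes {..<n}}"
abbreviation "permute \<sigma> \<equiv> frag_extend (\<lambda>x :: nat \<Rightarrow> 'b. frag_of (x \<circ> \<sigma>))"

lemma finite_perms: "finite perms"
  by (simp add: finite_permutations)

lemma perm_less: "\<sigma> permutes {..<n} \<Longrightarrow> i < n \<Longrightarrow> \<sigma> i < n"
  using permutes_in_image[of \<sigma> "{..<n}" i] by simp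

lemma tuple_comp_closed:
  assumes "\<sigma> permutes {..<n}" "x \<in> tuples R n"
  shows "x \<circ> \<sigma> \<in> tuples R n"
  using assms permutes_not_in[OF assms(1)] perm_less[OF assms(1)]
  by (auto simp: tuples_def PiE_def extensional_def Pi_def)

lemma permute_closed:
  assumes "\<sigma> permutes {..<n}" "c \<in> carrier F"
  shows "permute \<sigma> c \<in> carrier F"
  using assms(2)
  by (induction rule: tuple_ring_induct)
    (use assms(1) in \<open>simp_all add: frag_extend_diff tuple_ring_diff_closed frag_of_closed
      tuple_comp_closed[unfolded comp_def] comp_def, simp add: tuple_ring_simps\<close>)

lemma permute_mult:
  assumes \<sigma>: "\<sigma> permutes {..<n}" and "c \<in> carrier F" "d \<in> carrier F"
  shows "permute \<sigma> (c \<otimes>\<^bsub>F\<^esub> d) = permute \<sigma> c \<otimes>\<^bsub>F\<^esub> permute \<sigma> d"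
  using assms(2)
proof (induction rule: tuple_ring_induct)
  case (of x)
  have comp: "tuple_mult R n x y \<circ> \<sigma> = tuple_mult R n (x \<circ> \<sigma>) (y \<circ> \<sigma>)" for y
    using permutes_not_in[OF \<sigma>] perm_less[OF \<sigma>]
    by (auto simp: tuple_mult_def fun_eq_iff)
  show ?case
    using assms(3)
    by (induction rule: tuple_ring_induct)
      (simp_all add: tuple_ring_mult_0 tuple_ring_mult_of tuple_ring_mult_diff frag_extend_diff
        comp[unfolded comp_def] comp_def)
qed (simp_all add: tuple_ring_mult_0 tuple_ring_mult_diff frag_extend_diff)

text \<open>Permutations act by precomposition, hence from the right, and the order of composition
  is reversed.\<close>

lemma permute_permute: "permute \<sigma> (permute \<tau> c) = permute (\<tau> \<circ> \<sigma>) c"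
  using subset_UNIV[of "Poly_Mapping.keys c"]
  by (induction c rule: frag_induction) (simp_all add: frag_extend_diff comp_assoc)

lemma permute_id: "permute id c = c"
  using frag_expansion[of c] by simp

lemma upd_comp_perm:
  assumes "\<sigma> permutes S"
  shows "x(i := u) \<circ> \<sigma> = (x \<circ> \<sigma>)(inv_fun \<sigma> i := u)"
  using permutes_inverses[OF assms] by (auto simp: fun_eq_iff)

text \<open>A relation at the factors \<open>i\<close> and \<open>j\<close> becomes one of the same
  kind at their preimages under \<sigma>.\<close>

lemma permute_ideal:
  assumes \<sigma>: "\<sigma> permutes {..<n}" and "c \<in> I"
  shows "permute \<sigma> c \<in> I"
proof (rule tensor_ideal_preserved[where h = "permute \<sigma>", OF frag_extend_diff _ assms(2)])
  fix r assume "r \<in> tensor_rels A R n"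
  then show "permute \<sigma> r \<in> I"
  proof (cases rule: tensor_rels_cases)
    case (add x i u v)
    show ?thesis
      unfolding add(5) frag_extend_diff frag_extend_of upd_comp_perm[OF \<sigma>]
      by (intro tensor_ideal_of_rel tensor_rels_addI)
        (use add perm_less[OF permutes_inv[OF \<sigma>]] tuple_comp_closed[OF \<sigma>] in auto)
  next
    case (smult x i j a)
    have "x k = (x \<circ> \<sigma>) (inv_fun \<sigma> k)" for k using permutes_inverses[OF \<sigma>] by simp
    then show ?thesis
      unfolding smult(5) frag_extend_diff frag_extend_of upd_comp_perm[OF \<sigma>]
      using smult perm_less[OF permutes_inv[OF \<sigma>]] tuple_comp_closed[OF \<sigma>]
        tensor_rels_smultI[of "x \<circ> \<sigma>" "inv_fun \<sigma> i" "inv_fun \<sigma> j" a]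
      by (auto intro!: tensor_ideal_of_rel)
  qed
qed

lemma cls_eq: "cls c = (\<lambda>h. h + c) ` I"
  by (auto simp: a_r_coset_def' tuple_ring_simps)

text \<open>The image of a coset is again a full coset because the permutation maps the ideal onto
  itself; surjectivity comes from applying the inverse permutation.\<close>

lemma permute_factors_cls:
  assumes \<sigma>: "\<sigma> permutes {..<n}"
  shows "permute_factors \<sigma> (cls c) = cls (permute \<sigma> c)"
proof -
  have "permute \<sigma> ` I = I"
  proof (intro equalityI subsetI)
    fix h assume "h \<in> I"
    then have "permute (inv_fun \<sigma>) h \<in> I" using permutes_inv[OF \<sigma>] by (simp add: permute_ideal)
    moreover have "h = permute \<sigma> (permute (inv_fun \<sigma>) h)"
      by (simp only: permute_permute permutes_inv_o[OF \<sigma>] permute_id)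
    ultimately show "h \<in> permute \<sigma> ` I" by blast
  qed (use permute_ideal[OF \<sigma>] in auto)
  then have "(\<lambda>h. h + permute \<sigma> c) ` permute \<sigma> ` I = cls (permute \<sigma> c)" by (simp add: cls_eq)
  then show ?thesis
    unfolding permute_factors_def cls_eq by (simp add: image_image frag_extend_add)
qed

lemma permute_factors_hom:
  assumes \<sigma>: "\<sigma> permutes {..<n}"
  shows "permute_factors \<sigma> \<in> ring_hom T T"
proof (rule ring_hom_memI)
  fix t assume "t \<in> carrier T"
  then show "permute_factors \<sigma> t \<in> carrier T"
    by (auto simp: tensor_carrier permute_factors_cls[OF \<sigma>] permute_closed[OF \<sigma>])
next
  fix t u assume "t \<in> carrier T" "u \<in> carrier T"
  then obtain c d where c: "c \<in> carrier F" "t = cls c" and d: "d \<in> carrier F" "u = cls d"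
    by (auto simp: tensor_carrier)
  show "permute_factors \<sigma> (t \<otimes>\<^bsub>T\<^esub> u) = permute_factors \<sigma> t \<otimes>\<^bsub>T\<^esub> permute_factors \<sigma> u"
    using c d by (simp add: cls_mult permute_factors_cls[OF \<sigma>] permute_closed[OF \<sigma>] permute_mult[OF \<sigma>])
  show "permute_factors \<sigma> (t \<oplus>\<^bsub>T\<^esub> u) = permute_factors \<sigma> t \<oplus>\<^bsub>T\<^esub> permute_factors \<sigma> u"
    using c d by (simp add: cls_add permute_factors_cls[OF \<sigma>] permute_closed[OF \<sigma>] frag_extend_add)
next
  have "(\<lambda>i\<in>{..<n}. \<one>\<^bsub>R\<^esub>) \<circ> \<sigma> = (\<lambda>i\<in>{..<n}. \<one>\<^bsub>R\<^esub>)"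
    using permutes_not_in[OF \<sigma>] perm_less[OF \<sigma>] by (auto simp: fun_eq_iff)
  then show "permute_factors \<sigma> \<one>\<^bsub>T\<^esub> = \<one>\<^bsub>T\<^esub>"
    by (simp add: cls_one permute_factors_cls[OF \<sigma>] tuple_ring_simps)
qed

lemma permute_factors_hom_cring:
  "\<sigma> permutes {..<n} \<Longrightarrow> ring_hom_cring T T (permute_factors \<sigma>)"
  by (intro ring_hom_cring.intro ring_hom_cring_axioms.intro T.is_cring permute_factors_hom)

lemma permute_factors_closed:
  "\<sigma> permutes {..<n} \<Longrightarrow> t \<in> carrier T \<Longrightarrow> permute_factors \<sigma> t \<in> carrier T"
  using ring_hom_closed[OF permute_factors_hom] .

lemma permute_factors_pure:
  assumes \<sigma>: "\<sigma> permutes {..<n}"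
  shows "permute_factors \<sigma> (pure x) = pure (\<lambda>i. x (\<sigma> i))"
proof -
  have "restrict x {..<n} \<circ> \<sigma> = restrict (\<lambda>i. x (\<sigma> i)) {..<n}"
    using permutes_not_in[OF \<sigma>] perm_less[OF \<sigma>] by (auto simp: fun_eq_iff)
  then show ?thesis by (simp add: pure_eq_cls permute_factors_cls[OF \<sigma>])
qed

text \<open>The entry of the permuted tuple at \<open>i\<close> is the old entry at \<sigma>
  \<open>i\<close>, so \<open>z\<close> ends up where \<sigma> \<open>i\<close> equals
  \<open>p\<close>. This is the source of the inverse.\<close>

lemma permute_factors_coproj:
  assumes \<sigma>: "\<sigma> permutes {..<n}"
  shows "permute_factors \<sigma> (coproj A R n p z) = coproj A R n (inv_fun \<sigma> p) z"
  unfolding coproj_def permute_factors_pure[OF \<sigma>]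
  by (rule pure_cong) (use permutes_inv_eq[OF \<sigma>, of p] in \<open>simp add: eq_commute[of _ "inv_fun \<sigma> p"]\<close>)

section \<open>Symmetric tensors and their scalar action\<close>

abbreviation "TS \<equiv> sym_tensors A R n"

lemma sym_tensors_simps:
  "mult TS = mult T" "add TS = add T" "one TS = one T" "zero TS = zero T" "smult TS = smult T"
  "t \<in> carrier TS \<longleftrightarrow> t \<in> carrier T \<and> (\<forall>\<sigma>. \<sigma> permutes {..<n} \<longrightarrow> permute_factors \<sigma> t = t)"
  by (simp_all add: sym_tensors_def)

lemma sym_tensors_eq: "TS = T\<lparr>carrier := carrier TS\<rparr>"
  by (simp add: sym_tensors_def)

lemma sym_tensors_subring: "subring (carrier TS) T"
proof (rule T.subringI)
  show "carrier TS \<subseteq> carrier T" by (auto simp: sym_tensors_simps)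
  show "\<one>\<^bsub>T\<^esub> \<in> carrier TS"
    using ring_hom_one[OF permute_factors_hom] by (simp add: sym_tensors_simps)
next
  fix t assume "t \<in> carrier TS"
  then show "\<ominus>\<^bsub>T\<^esub> t \<in> carrier TS"
    using ring_hom_cring.hom_a_inv[OF permute_factors_hom_cring]
    by (simp add: sym_tensors_simps)
next
  fix t u assume "t \<in> carrier TS" "u \<in> carrier TS"
  then show "t \<otimes>\<^bsub>T\<^esub> u \<in> carrier TS" "t \<oplus>\<^bsub>T\<^esub> u \<in> carrier TS"
    using ring_hom_mult[OF permute_factors_hom] ring_hom_add[OF permute_factors_hom]
    by (simp_all add: sym_tensors_simps)
qed

sublocale TS: cring TS
  using T.subcring_iff[OF subringE(1)[OF sym_tensors_subring]] T.subcringI'[OF sym_tensors_subring]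
    sym_tensors_eq by simp

lemma power_sum_closed: "z \<in> carrier R \<Longrightarrow> power_sum A R n z \<in> carrier TS"
  unfolding sym_tensors_simps
proof (intro conjI allI impI)
  assume z: "z \<in> carrier R"
  show "power_sum A R n z \<in> carrier T"
    unfolding power_sum_def by (intro T.finsum_closed Pi_I coproj_closed z)
  fix \<sigma> assume \<sigma>: "\<sigma> permutes {..<n}"
  interpret h: ring_hom_cring T T "permute_factors \<sigma>" using \<sigma> by (rule permute_factors_hom_cring)
  have "permute_factors \<sigma> (power_sum A R n z) =
      (\<Oplus>\<^bsub>T\<^esub>p\<in>{..<n}. permute_factors \<sigma> (coproj A R n p z))"
    unfolding power_sum_def using z by (subst h.hom_finsum) (auto simp: coproj_closed comp_def)
  also have "\<dots> = (\<Oplus>\<^bsub>T\<^esub>p\<in>{..<n}. coproj A R n (inv_fun \<sigma> p) z)"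
    by (simp add: permute_factors_coproj[OF \<sigma>])
  also have "\<dots> = (\<Oplus>\<^bsub>T\<^esub>p\<in>inv_fun \<sigma> ` {..<n}. coproj A R n p z)"
    by (rule T.finsum_reindex[symmetric])
      (use z permutes_inj_on[OF permutes_inv[OF \<sigma>]] in \<open>auto intro: coproj_closed\<close>)
  also have "\<dots> = power_sum A R n z"
    by (simp add: power_sum_def permutes_image[OF permutes_inv[OF \<sigma>]])
  finally show "permute_factors \<sigma> (power_sum A R n z) = power_sum A R n z" .
qed

lemma smult_eq: "a \<odot>\<^bsub>TS\<^esub> t = coproj A R n 0 (a \<odot>\<^bsub>R\<^esub> \<one>\<^bsub>R\<^esub>) \<otimes>\<^bsub>T\<^esub> t"
  by (simp add: sym_tensors_simps tensor_power_simps(6))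

text \<open>A permutation carries the scalar from factor \<open>0\<close> to another factor, and the
  scalar relations carry it back. \<open>n \<ge> 1\<close> ensures that factor \<open>0\<close>
  exists.\<close>

lemma scalar_sym:
  assumes "a \<in> carrier A" "n \<ge> 1"
  shows "coproj A R n 0 (a \<odot>\<^bsub>R\<^esub> \<one>\<^bsub>R\<^esub>) \<in> carrier TS"
proof -
  have "permute_factors \<sigma> (coproj A R n 0 (a \<odot>\<^bsub>R\<^esub> \<one>\<^bsub>R\<^esub>)) = coproj A R n 0 (a \<odot>\<^bsub>R\<^esub> \<one>\<^bsub>R\<^esub>)"
    if \<sigma>: "\<sigma> permutes {..<n}" for \<sigma>
    unfolding permute_factors_coproj[OF \<sigma>]
    using assms perm_less[OF permutes_inv[OF \<sigma>]] by (intro coproj_scalar) auto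
  then show ?thesis using assms by (simp add: sym_tensors_simps coproj_closed smult_closed)
qed

lemma sym_smult_closed:
  "n \<ge> 1 \<Longrightarrow> a \<in> carrier A \<Longrightarrow> t \<in> carrier TS \<Longrightarrow> a \<odot>\<^bsub>TS\<^esub> t \<in> carrier TS"
  unfolding smult_eq by (rule subringE(6)[OF sym_tensors_subring scalar_sym])

lemma sym_smult_mult:
  assumes "n \<ge> 1" "a \<in> carrier A" "t \<in> carrier TS" "u \<in> carrier TS"
  shows "(a \<odot>\<^bsub>TS\<^esub> t) \<otimes>\<^bsub>TS\<^esub> u = a \<odot>\<^bsub>TS\<^esub> (t \<otimes>\<^bsub>TS\<^esub> u)"
  using TS.m_assoc[OF scalar_sym[OF assms(2,1)] assms(3,4)]
  unfolding smult_eq by (simp add: sym_tensors_simps)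

section \<open>The subalgebra generated by the power sums\<close>

abbreviation "P \<equiv> carrier (power_sum_algebra A R n)"

lemma P_eq: "P = \<Inter>{B. is_subalgebra A TS B \<and> power_sum A R n ` carrier R \<subseteq> B}"
  by (simp add: power_sum_algebra_def generated_subalgebra_def)

lemma power_sum_algebra_eq: "power_sum_algebra A R n = TS\<lparr>carrier := P\<rparr>"
  by (simp add: power_sum_algebra_def generated_subalgebra_def)

lemma P_subring_TS: "n \<ge> 1 \<Longrightarrow> subring P TS"
proof -
  assume n: "n \<ge> 1"
  \<comment> \<open>The whole ring of symmetric tensors is one of the subalgebras in the
    intersection, which is thus taken over a nonempty family.\<close>
  have "is_subalgebra A TS (carrier TS)"
    using sym_smult_closed[OF n] TS.carrier_is_subring by (simp add: is_subalgebra_def)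
  then show ?thesis
    unfolding P_eq
    by (intro TS.subring_Inter) (use power_sum_closed in \<open>auto simp: is_subalgebra_def\<close>)
qed

text \<open>Traces and sums over injections are formed from co-projections, which need not be
  symmetric, so membership in \<open>P\<close> has to be argued inside \<open>T\<close>.\<close>

lemma P_subring:
  assumes "n \<ge> 1"
  shows "subring P T"
proof (rule T.ring_incl_imp_subring)
  show "P \<subseteq> carrier T"
    using subringE(1)[OF P_subring_TS[OF assms]] subringE(1)[OF sym_tensors_subring] by blast
  have "T\<lparr>carrier := P\<rparr> = TS\<lparr>carrier := P\<rparr>" by (simp add: sym_tensors_def)
  then show "ring (T\<lparr>carrier := P\<rparr>)"
    using TS.subring_is_ring[OF P_subring_TS[OF assms]] by simp
qed

lemma P_smult_closed: "a \<in> carrier A \<Longrightarrow> b \<in> P \<Longrightarrow> a \<odot>\<^bsub>TS\<^esub> b \<in> P"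
  unfolding P_eq by (auto simp: is_subalgebra_def)

lemma power_sum_in_P: "z \<in> carrier R \<Longrightarrow> power_sum A R n z \<in> P"
  unfolding P_eq by auto


section \<open>The trace\<close>

text \<open>Defined on all tensors: it is applied to multiples of a pure tensor, which are in
  general not symmetric.\<close>

definition trace :: "((nat \<Rightarrow> 'b) \<Rightarrow>\<^sub>0 int) set \<Rightarrow> ((nat \<Rightarrow> 'b) \<Rightarrow>\<^sub>0 int) set"
  where "trace t = (\<Oplus>\<^bsub>T\<^esub>\<sigma>\<in>perms. permute_factors \<sigma> t)"

lemma trace_pure_in_P:
  assumes n: "n \<ge> 1" and x: "\<And>i. i < n \<Longrightarrow> x i \<in> carrier R"
  shows "trace (pure x) \<in> P"
proof -
  let ?g = "\<lambda>f. \<Otimes>\<^bsub>T\<^esub>j\<in>{..<n}. coproj A R n (f j) (x j)"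
  have gc: "?g f \<in> carrier T" for f by (rule T.finprod_closed) (use x in \<open>auto intro: coproj_closed\<close>)
  \<comment> \<open>Reordering the product keeps each \<open>x j\<close> in place and moves its
    position instead. This is the form of a summand over injections, where \<open>j\<close> is sent
    to a factor.\<close>
  have pe: "permute_factors \<sigma> (pure x) = ?g (inv_fun \<sigma>)" if \<sigma>: "\<sigma> permutes {..<n}" for \<sigma>
  proof -
    have "permute_factors \<sigma> (pure x) = (\<Otimes>\<^bsub>T\<^esub>p\<in>{..<n}. coproj A R n p (x (\<sigma> p)))"
      unfolding permute_factors_pure[OF \<sigma>] by (rule pure_eq_finprod) (use x perm_less[OF \<sigma>] in auto)
    also have "\<dots> = (\<Otimes>\<^bsub>T\<^esub>p\<in>{..<n}. coproj A R n (inv_fun \<sigma> (\<sigma> p)) (x (\<sigma> p)))"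
      using permutes_inverses[OF \<sigma>] by simp
    also have "\<dots> = (\<Otimes>\<^bsub>T\<^esub>j\<in>\<sigma> ` {..<n}. coproj A R n (inv_fun \<sigma> j) (x j))"
      by (rule T.finprod_reindex[symmetric])
        (use x perm_less[OF \<sigma>] permutes_inj_on[OF \<sigma>] in \<open>auto intro: coproj_closed\<close>)
    finally show ?thesis by (simp add: permutes_image[OF \<sigma>])
  qed
  have "trace (pure x) = (\<Oplus>\<^bsub>T\<^esub>\<sigma>\<in>perms. ?g (inv_fun \<sigma>))"
    unfolding trace_def by (rule T.finsum_cong') (use pe gc in auto)
  \<comment> \<open>The sum runs over a group, so passing to inverses only reorders it.\<close>
  also have "\<dots> = (\<Oplus>\<^bsub>T\<^esub>\<sigma>\<in>inv_fun ` perms. ?g \<sigma>)"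
    by (rule T.finsum_reindex[symmetric]) (use gc bij_betw_inv_permutations in \<open>auto simp: bij_betw_def\<close>)
  also have "inv_fun ` perms = perms" using bij_betw_inv_permutations by (rule bij_betw_imp_surj_on)
  \<comment> \<open>\<open>?g\<close> reads its argument only below \<open>n\<close>; restricting
    adapts the default value to extensional functions.\<close>
  also have "(\<Oplus>\<^bsub>T\<^esub>\<sigma>\<in>perms. ?g \<sigma>) = (\<Oplus>\<^bsub>T\<^esub>\<sigma>\<in>perms. ?g (restrict \<sigma> {..<n}))"
  proof (rule T.finsum_cong')
    fix \<sigma>
    show "?g \<sigma> = ?g (restrict \<sigma> {..<n})"
      by (rule T.finprod_cong') (use x in \<open>auto intro: coproj_closed\<close>)
  qed (use gc in auto)
  also have "\<dots> = (\<Oplus>\<^bsub>T\<^esub>f\<in>(\<lambda>\<sigma>. restrict \<sigma> {..<n}) ` perms. ?g f)"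
    by (rule T.finsum_reindex[OF _ bij_betw_imp_inj_on[OF bij_betw_permutations_injections],
          symmetric]) (use gc in auto)
  also have "(\<lambda>\<sigma>. restrict \<sigma> {..<n}) ` perms = injections n {..<n}"
    using bij_betw_permutations_injections by (rule bij_betw_imp_surj_on)
  also have "(\<Oplus>\<^bsub>T\<^esub>f\<in>injections n {..<n}. ?g f) \<in> P"
  \<comment> \<open>\<open>G\<close> consists of the families of co-projections of a fixed element.
    It is closed under products because each co-projection is multiplicative, and summing a family
    over all factors gives a power sum.\<close>
  proof (rule T.injection_sum_mem_subring[OF P_subring[OF n] finite_lessThan,
      where G = "(\<lambda>z p. coproj A R n p z) ` carrier R" and g = "\<lambda>j p. coproj A R n p (x j)"])
    fix g h assume "g \<in> (\<lambda>z p. coproj A R n p z) ` carrier R" "h \<in> (\<lambda>z p. coproj A R n p z) ` carrier R"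
    then obtain z w where "z \<in> carrier R" "w \<in> carrier R"
      "g = (\<lambda>p. coproj A R n p z)" "h = (\<lambda>p. coproj A R n p w)" by blast
    then show "\<exists>e\<in>(\<lambda>z p. coproj A R n p z) ` carrier R. \<forall>p\<in>{..<n}. e p = g p \<otimes>\<^bsub>T\<^esub> h p"
      by (intro bexI[where x = "\<lambda>p. coproj A R n p (z \<otimes>\<^bsub>R\<^esub> w)"]) (auto simp: coproj_mult)
  next
    fix g assume "g \<in> (\<lambda>z p. coproj A R n p z) ` carrier R"
    then show "(\<Oplus>\<^bsub>T\<^esub>p\<in>{..<n}. g p) \<in> P" using power_sum_in_P by (auto simp: power_sum_def)
  qed (use x coproj_closed in auto)
  finally show ?thesis .
qed

lemma trace_in_P:
  assumes n: "n \<ge> 1" and "t \<in> carrier T"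
  shows "trace t \<in> P"
  using assms(2)
proof (induction rule: tensor_induct)
  case zero
  have "trace \<zero>\<^bsub>T\<^esub> = \<zero>\<^bsub>T\<^esub>"
    unfolding trace_def
    by (rule T.add.finprod_one_eqI) (use ring_hom_cring.hom_zero[OF permute_factors_hom_cring] in auto)
  then show ?case using subringE(2)[OF P_subring[OF n]] by simp
next
  case (pure x)
  then show ?case using trace_pure_in_P[OF n] by blast
next
  case (diff t u)
  \<comment> \<open>Additivity is used in the form \<open>t = (t - u) + u\<close>, which later
    expresses the trace of a difference through the traces of \<open>t\<close> and
    \<open>u\<close>.\<close>
  have d: "permute_factors \<sigma> t = permute_factors \<sigma> (t \<ominus>\<^bsub>T\<^esub> u) \<oplus>\<^bsub>T\<^esub> permute_factors \<sigma> u"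
    if \<sigma>: "\<sigma> permutes {..<n}" for \<sigma>
    using ring_hom_add[OF permute_factors_hom[OF \<sigma>], of "t \<ominus>\<^bsub>T\<^esub> u" u] diff(1,2)
    by (simp add: T.minus_eq T.a_assoc T.l_neg)
  have tc: "trace v \<in> carrier T" if "v \<in> carrier T" for v
    unfolding trace_def using that permute_factors_closed by (intro T.finsum_closed) auto
  have "trace t = (\<Oplus>\<^bsub>T\<^esub>\<sigma>\<in>perms. permute_factors \<sigma> (t \<ominus>\<^bsub>T\<^esub> u) \<oplus>\<^bsub>T\<^esub> permute_factors \<sigma> u)"
    unfolding trace_def
    by (rule T.finsum_cong') (use d diff(1,2) permute_factors_closed in auto)
  also have "\<dots> = trace (t \<ominus>\<^bsub>T\<^esub> u) \<oplus>\<^bsub>T\<^esub> trace u"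
    unfolding trace_def
    by (rule T.finsum_addf) (use diff(1,2) permute_factors_closed in auto)
  finally have "trace (t \<ominus>\<^bsub>T\<^esub> u) = trace t \<oplus>\<^bsub>T\<^esub> (\<ominus>\<^bsub>T\<^esub> trace u)"
    using tc diff(1,2) by (simp add: T.a_assoc T.r_neg)
  then show ?case using diff(3,4) subringE(5,7)[OF P_subring[OF n]] by simp
qed


section \<open>The alternating tensor\<close>

text \<open>Replaces the integer multiple by \<plusminus>1 with multiplication by a ring element, so
  that signs obey the ring laws and are fixed by every permutation of the factors.\<close>

definition sign_elt :: "(nat \<Rightarrow> nat) \<Rightarrow> ((nat \<Rightarrow> 'b) \<Rightarrow>\<^sub>0 int) set"
  where "sign_elt \<sigma> = (if sign \<sigma> = (1::int) then \<one>\<^bsub>T\<^esub> else \<ominus>\<^bsub>T\<^esub> \<one>\<^bsub>T\<^esub>)"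

lemma sign_elt_closed: "sign_elt \<sigma> \<in> carrier T"
  by (simp add: sign_elt_def)

lemma sign_smult_eq:
  assumes "t \<in> carrier T"
  shows "[sign \<sigma>] \<cdot>\<^bsub>T\<^esub> t = sign_elt \<sigma> \<otimes>\<^bsub>T\<^esub> t"
proof (cases "evenperm \<sigma>")
  case True
  then show ?thesis using assms T.add.int_pow_1 by (simp add: sign_elt_def sign_def)
next
  case False
  then show ?thesis using assms by (simp add: sign_elt_def sign_def T.l_minus T.add.int_pow_neg)
qed

lemma sign_elt_compose:
  assumes "\<sigma> permutes {..<n}" "\<tau> permutes {..<n}"
  shows "sign_elt (\<sigma> \<circ> \<tau>) = sign_elt \<sigma> \<otimes>\<^bsub>T\<^esub> sign_elt \<tau>"
proof -
  have "permutation \<sigma>" "permutation \<tau>" using assms by (auto simp: permutation_permutes)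
  then show ?thesis
    by (simp add: sign_elt_def evenperm_comp sign_def T.l_minus)
qed

lemma sign_elt_square: "sign_elt \<sigma> \<otimes>\<^bsub>T\<^esub> sign_elt \<sigma> = \<one>\<^bsub>T\<^esub>"
  by (simp add: sign_elt_def T.l_minus)

lemma permute_factors_sign_elt: "\<tau> permutes {..<n} \<Longrightarrow> permute_factors \<tau> (sign_elt \<sigma>) = sign_elt \<sigma>"
  using ring_hom_cring.hom_a_inv[OF permute_factors_hom_cring, of \<tau> "\<one>\<^bsub>T\<^esub>"]
    ring_hom_one[OF permute_factors_hom, of \<tau>]
  by (simp add: sign_elt_def)

lemma alt_tensor_eq:
  assumes x: "x \<in> {..<n} \<rightarrow> carrier R"
  shows "alt_tensor A R n x = (\<Oplus>\<^bsub>T\<^esub>\<sigma>\<in>perms. sign_elt \<sigma> \<otimes>\<^bsub>T\<^esub> pure (\<lambda>i. x (\<sigma> i)))"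
  unfolding alt_tensor_def
  by (rule T.finsum_cong')
    (use x perm_less in \<open>auto simp: Pi_iff intro!: sign_smult_eq pure_closed sign_elt_closed T.m_closed\<close>)

lemma alt_tensor_closed:
  assumes x: "x \<in> {..<n} \<rightarrow> carrier R"
  shows "alt_tensor A R n x \<in> carrier T"
  unfolding alt_tensor_eq[OF x]
  by (rule T.finsum_closed) (use x perm_less in \<open>auto simp: Pi_iff intro!: pure_closed sign_elt_closed\<close>)

text \<open>Applying \<tau> to the summand of \<sigma> gives the pure tensor of
  \<open>\<sigma> \<circ> \<tau>\<close>, and right translation by \<tau> is a bijection of the
  permutations. Rewriting the sign in terms of \<open>\<sigma> \<circ> \<tau>\<close> leaves the
  common factor \<open>sign_elt \<tau>\<close>.\<close>

lemma permute_factors_alt_tensor: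
  assumes x: "x \<in> {..<n} \<rightarrow> carrier R" and \<tau>: "\<tau> permutes {..<n}"
  shows "permute_factors \<tau> (alt_tensor A R n x) = sign_elt \<tau> \<otimes>\<^bsub>T\<^esub> alt_tensor A R n x"
proof -
  interpret h: ring_hom_cring T T "permute_factors \<tau>" using \<tau> by (rule permute_factors_hom_cring)
  let ?p = "\<lambda>\<sigma>. pure (\<lambda>i. x (\<sigma> i))"
  have pc: "?p \<sigma> \<in> carrier T" if "\<sigma> permutes {..<n}" for \<sigma>
    by (rule pure_closed) (use x perm_less that in \<open>auto simp: Pi_iff\<close>)
  have "permute_factors \<tau> (alt_tensor A R n x) = (\<Oplus>\<^bsub>T\<^esub>\<sigma>\<in>perms. permute_factors \<tau> (sign_elt \<sigma> \<otimes>\<^bsub>T\<^esub> ?p \<sigma>))"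
    unfolding alt_tensor_eq[OF x]
    by (subst h.hom_finsum) (use pc sign_elt_closed in \<open>auto simp: comp_def\<close>)
  also have "\<dots> = (\<Oplus>\<^bsub>T\<^esub>\<sigma>\<in>perms. sign_elt \<tau> \<otimes>\<^bsub>T\<^esub> (sign_elt (\<sigma> \<circ> \<tau>) \<otimes>\<^bsub>T\<^esub> ?p (\<sigma> \<circ> \<tau>)))"
  proof (rule T.finsum_cong')
    show "(\<lambda>\<sigma>. sign_elt \<tau> \<otimes>\<^bsub>T\<^esub> (sign_elt (\<sigma> \<circ> \<tau>) \<otimes>\<^bsub>T\<^esub> ?p (\<sigma> \<circ> \<tau>))) \<in> perms \<rightarrow> carrier T"
      using pc[OF permutes_compose[OF \<tau>]] sign_elt_closed by (auto simp: comp_def)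
    fix \<sigma> assume "\<sigma> \<in> perms"
    then have \<sigma>: "\<sigma> permutes {..<n}" by simp
    have c: "?p (\<sigma> \<circ> \<tau>) \<in> carrier T" using pc[OF permutes_compose[OF \<tau> \<sigma>]] .
    \<comment> \<open>The sign of \<tau> may be moved to the other side because its square is
      \<open>1\<close>.\<close>
    have sg: "sign_elt \<sigma> = sign_elt \<tau> \<otimes>\<^bsub>T\<^esub> sign_elt (\<sigma> \<circ> \<tau>)"
      using sign_elt_closed sign_elt_square[of \<tau>]
      by (simp add: sign_elt_compose[OF \<sigma> \<tau>] T.m_lcomm[of "sign_elt \<tau>" "sign_elt \<sigma>" "sign_elt \<tau>"])
    have "permute_factors \<tau> (sign_elt \<sigma> \<otimes>\<^bsub>T\<^esub> ?p \<sigma>) = sign_elt \<sigma> \<otimes>\<^bsub>T\<^esub> ?p (\<sigma> \<circ> \<tau>)"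
      using pc[OF \<sigma>] sign_elt_closed permute_factors_sign_elt[OF \<tau>] permute_factors_pure[OF \<tau>] by simp
    also have "\<dots> = (sign_elt \<tau> \<otimes>\<^bsub>T\<^esub> sign_elt (\<sigma> \<circ> \<tau>)) \<otimes>\<^bsub>T\<^esub> ?p (\<sigma> \<circ> \<tau>)"
      by (simp only: sg[symmetric])
    also have "\<dots> = sign_elt \<tau> \<otimes>\<^bsub>T\<^esub> (sign_elt (\<sigma> \<circ> \<tau>) \<otimes>\<^bsub>T\<^esub> ?p (\<sigma> \<circ> \<tau>))"
      by (rule T.m_assoc[OF sign_elt_closed sign_elt_closed c])
    finally show "permute_factors \<tau> (sign_elt \<sigma> \<otimes>\<^bsub>T\<^esub> ?p \<sigma>) =
        sign_elt \<tau> \<otimes>\<^bsub>T\<^esub> (sign_elt (\<sigma> \<circ> \<tau>) \<otimes>\<^bsub>T\<^esub> ?p (\<sigma> \<circ> \<tau>))" .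
  qed simp
  also have "\<dots> = sign_elt \<tau> \<otimes>\<^bsub>T\<^esub> (\<Oplus>\<^bsub>T\<^esub>\<sigma>\<in>perms. sign_elt (\<sigma> \<circ> \<tau>) \<otimes>\<^bsub>T\<^esub> ?p (\<sigma> \<circ> \<tau>))"
    by (rule T.finsum_rdistr[symmetric])
      (use finite_perms sign_elt_closed pc[OF permutes_compose[OF \<tau>]] in \<open>auto simp: comp_def\<close>)
  also have "(\<Oplus>\<^bsub>T\<^esub>\<sigma>\<in>perms. sign_elt (\<sigma> \<circ> \<tau>) \<otimes>\<^bsub>T\<^esub> ?p (\<sigma> \<circ> \<tau>)) =
      (\<Oplus>\<^bsub>T\<^esub>\<rho>\<in>(\<lambda>\<sigma>. \<sigma> \<circ> \<tau>) ` perms. sign_elt \<rho> \<otimes>\<^bsub>T\<^esub> ?p \<rho>)"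
  proof (rule T.finsum_reindex[symmetric])
    show "inj_on (\<lambda>\<sigma>. \<sigma> \<circ> \<tau>) perms"
      using bij_betw_comp_permutations[OF \<tau>] by (rule bij_betw_imp_inj_on)
    show "(\<lambda>\<rho>. sign_elt \<rho> \<otimes>\<^bsub>T\<^esub> ?p \<rho>) \<in> (\<lambda>\<sigma>. \<sigma> \<circ> \<tau>) ` perms \<rightarrow> carrier T"
      unfolding bij_betw_imp_surj_on[OF bij_betw_comp_permutations[OF \<tau>]]
      using pc sign_elt_closed by auto
  qed
  also have "\<dots> = alt_tensor A R n x"
    unfolding bij_betw_imp_surj_on[OF bij_betw_comp_permutations[OF \<tau>]] alt_tensor_eq[OF x] ..
  finally show ?thesis .
qed

text \<open>The sign of the summand \<sigma> times \<alpha> is the \<sigma>-image of \<alpha>, and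
  \<open>t\<close> is its own \<sigma>-image. Each summand is therefore the \<sigma>-image of one
  fixed tensor.\<close>

lemma alt_tensor_sq_mult_eq_trace:
  assumes x: "x \<in> {..<n} \<rightarrow> carrier R" and t: "t \<in> carrier TS"
  shows "alt_tensor_sq A R n x \<otimes>\<^bsub>T\<^esub> t = trace (pure x \<otimes>\<^bsub>T\<^esub> (alt_tensor A R n x \<otimes>\<^bsub>T\<^esub> t))"
proof -
  let ?a = "alt_tensor A R n x"
  let ?p = "\<lambda>\<sigma>. pure (\<lambda>i. x (\<sigma> i))"
  have a: "?a \<in> carrier T" using x by (rule alt_tensor_closed)
  have tT: "t \<in> carrier T" using t by (simp add: sym_tensors_simps)
  have pc: "?p \<sigma> \<in> carrier T" if "\<sigma> permutes {..<n}" for \<sigma>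
    by (rule pure_closed) (use x perm_less that in \<open>auto simp: Pi_iff\<close>)
  have px: "pure x \<in> carrier T" by (rule pure_closed) (use x in auto)
  have "alt_tensor_sq A R n x \<otimes>\<^bsub>T\<^esub> t = ?a \<otimes>\<^bsub>T\<^esub> (?a \<otimes>\<^bsub>T\<^esub> t)"
    unfolding alt_tensor_sq_def using a tT by (simp add: T.m_assoc)
  also have "\<dots> = (\<Oplus>\<^bsub>T\<^esub>\<sigma>\<in>perms. sign_elt \<sigma> \<otimes>\<^bsub>T\<^esub> ?p \<sigma>) \<otimes>\<^bsub>T\<^esub> (?a \<otimes>\<^bsub>T\<^esub> t)"
    \<comment> \<open>Only the first of the two factors \<alpha> is expanded; the second must stay
      whole in order to absorb the signs.\<close>
    by (subst (1) alt_tensor_eq[OF x]) simp_all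
  also have "\<dots> = (\<Oplus>\<^bsub>T\<^esub>\<sigma>\<in>perms. (sign_elt \<sigma> \<otimes>\<^bsub>T\<^esub> ?p \<sigma>) \<otimes>\<^bsub>T\<^esub> (?a \<otimes>\<^bsub>T\<^esub> t))"
    by (rule T.finsum_ldistr) (use finite_perms pc sign_elt_closed a tT in auto)
  also have "\<dots> = trace (pure x \<otimes>\<^bsub>T\<^esub> (?a \<otimes>\<^bsub>T\<^esub> t))"
    unfolding trace_def
  proof (rule T.finsum_cong')
    show "(\<lambda>\<sigma>. permute_factors \<sigma> (pure x \<otimes>\<^bsub>T\<^esub> (?a \<otimes>\<^bsub>T\<^esub> t))) \<in> perms \<rightarrow> carrier T"
      using px a tT by (auto intro!: permute_factors_closed)
    fix \<sigma> assume "\<sigma> \<in> perms"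
    then have \<sigma>: "\<sigma> permutes {..<n}" by simp
    interpret h: ring_hom_cring T T "permute_factors \<sigma>" using \<sigma> by (rule permute_factors_hom_cring)
    have "permute_factors \<sigma> (pure x \<otimes>\<^bsub>T\<^esub> (?a \<otimes>\<^bsub>T\<^esub> t)) = ?p \<sigma> \<otimes>\<^bsub>T\<^esub> ((sign_elt \<sigma> \<otimes>\<^bsub>T\<^esub> ?a) \<otimes>\<^bsub>T\<^esub> t)"
      using px a tT t \<sigma>
      by (simp add: permute_factors_pure[OF \<sigma>] permute_factors_alt_tensor[OF x \<sigma>] sym_tensors_simps)
    also have "\<dots> = (sign_elt \<sigma> \<otimes>\<^bsub>T\<^esub> ?p \<sigma>) \<otimes>\<^bsub>T\<^esub> (?a \<otimes>\<^bsub>T\<^esub> t)"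
      using pc[OF \<sigma>] a tT sign_elt_closed by (simp add: T.m_ac)
    finally show "(sign_elt \<sigma> \<otimes>\<^bsub>T\<^esub> ?p \<sigma>) \<otimes>\<^bsub>T\<^esub> (?a \<otimes>\<^bsub>T\<^esub> t) =
        permute_factors \<sigma> (pure x \<otimes>\<^bsub>T\<^esub> (?a \<otimes>\<^bsub>T\<^esub> t))" ..
  qed simp
  finally show ?thesis .
qed

lemma alt_tensor_sq_mult_in_P:
  assumes "n \<ge> 1" "x \<in> {..<n} \<rightarrow> carrier R" "t \<in> carrier TS"
  shows "alt_tensor_sq A R n x \<otimes>\<^bsub>T\<^esub> t \<in> P"
  unfolding alt_tensor_sq_mult_eq_trace[OF assms(2,3)]
  using assms alt_tensor_closed[OF assms(2)]
  by (intro trace_in_P T.m_closed pure_closed) (auto simp: sym_tensors_simps)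

text \<open>The case \<open>t = 1\<close> of the preceding membership, the unit being
  symmetric.\<close>

lemma alt_tensor_sq_in_P:
  assumes "n \<ge> 1" "x \<in> {..<n} \<rightarrow> carrier R"
  shows "alt_tensor_sq A R n x \<in> P"
  using alt_tensor_sq_mult_in_P[OF assms TS.one_closed] alt_tensor_closed[OF assms(2)]
  by (simp add: alt_tensor_sq_def sym_tensors_simps)

end

theorem proposition3p7:
  fixes A :: "('a, 'k) ring_scheme"
    and R :: "('a, 'b, 'm) module_scheme"
    and n :: nat
    and x :: "nat \<Rightarrow> 'b"
  assumes "algebra A R"
    and "n \<ge> 1"
    and "\<And>i. i < n \<Longrightarrow> x i \<in> carrier R"
  shows "alt_tensor_sq A R n x \<in> carrier (power_sum_algebra A R n) \<and>
    localization_map (\<lambda>t. t) (sym_tensors A R n) (alt_tensor_sq A R n x)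
      \<in> algebra_iso A
          (localization (power_sum_algebra A R n) (alt_tensor_sq A R n x))
          (localization (sym_tensors A R n) (alt_tensor_sq A R n x))"
proof -
  interpret algebra_power A R n using assms(1) by (rule algebra_power.intro)
  have x: "x \<in> {..<n} \<rightarrow> carrier R" using assms(3) by auto
  have f: "alt_tensor_sq A R n x \<in> P" using assms(2) x by (rule alt_tensor_sq_in_P)
  moreover have "localization_map (\<lambda>t. t) TS (alt_tensor_sq A R n x)
      \<in> algebra_iso A (localization (TS\<lparr>carrier := P\<rparr>) (alt_tensor_sq A R n x))
          (localization TS (alt_tensor_sq A R n x))"
    \<comment> \<open>Here \<open>B\<close> is \<open>P\<close> and the conductor element is
      \<alpha>^2. What remains are the closure and compatibility of scalars and the fact that
      \<alpha>^2 multiplies symmetric tensors into \<open>P\<close>.\<close>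
    by (rule localization_map_inclusion_iso[OF TS.is_cring P_subring_TS[OF assms(2)] f])
      (use assms(2) x P_smult_closed sym_smult_closed sym_smult_mult alt_tensor_sq_mult_in_P
        in \<open>auto simp: sym_tensors_simps(1)\<close>)
  ultimately show ?thesis by (simp flip: power_sum_algebra_eq)
qed

end
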